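(* Let conditions (Reg1)-(Reg3) (stated in the context) hold, and assume that $p<n$ is fixed. Set $$a_n^1:=\max\{\lambda_n^1 w_1^{(j)}:\ j\le J\},\qquad a_n^0:=\max\{\lambda_n^0 w_0^{(j,rs)}:\ 1\le r<s\le p_j,\ j=1,\dots,J\},$$ and assume $a_n^1/\sqrt n\to_P 0$ and $a_n^0\to_P K$, where $K\in\mathbb R$ is some arbitrary constant. Assume also that the true underlying structure is sparse (defined in the context). Then there exists an $L_0$-FGL estimator $\hat{\boldsymbol\beta}=\hat{\boldsymbol\beta}^{(n)}$ for which, for every $\varepsilon>0$, there exists a constant $N>0$ such that $$\mathbb P(A^*\not\subseteq A_n)<\varepsilon\qquad\forall\,n\ge N,$$ where $A^*=\{j:\boldsymbol\beta_j^*\ne\boldsymbol0\}$ and $A_n=\{j:\hat{\boldsymbol\beta}_j^{(n)}\ne\boldsymbol0\}$.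
   Context: Setting: there are $J$ categorical covariates (factors); factor $j$ has $p_j+1$ levels $0,1,\dots,p_j$, level $0$ being the reference category, and $p=\sum_{j=1}^Jp_j$; $J$ and the $p_j$ are fixed. The parameter vector is $\boldsymbol\beta=(\beta_0,\boldsymbol\beta_1,\dots,\boldsymbol\beta_J)\in\mathbb R^{p+1}$ with intercept $\beta_0$, $\boldsymbol\beta_j=(\beta_{j,1},\dots,\beta_{j,p_j})$ and the convention $\beta_{j,0}=0$. Observations $\boldsymbol v_i=(y_i,\boldsymbol x_i)$, $i=1,\dots,n$, are i.i.d. copies of $\boldsymbol v=(y,\boldsymbol x)$ with $y\in\{0,1\}$ and $\boldsymbol x=(1,\boldsymbol x_1,\dots,\boldsymbol x_J)\in\mathbb R^{p+1}$, where $\boldsymbol x_j\in\{0,1\}^{p_j}$ is the dummy coding of factor $j$ (its $k$-th entry is $1$ iff factor $j$ takes level $k$). The data follow the logistic regression model $\mathbb E(y\mid\boldsymbol x)=\exp(\boldsymbol x^T\boldsymbol\beta)/(1+\exp(\boldsymbol x^T\boldsymbol\beta))$ with true parameter $\boldsymbol\beta=\boldsymbol\beta^*$ (vectors $\boldsymbol x$ regarded as columns). The log likelihood is $L_n(\boldsymbol\beta)=\sum_{i=1}^n\log f(\boldsymbol v_i,\boldsymbol\beta)$. $L_0$-FGL estimator: a minimizer of $$M_{pen}(\boldsymbol\beta)=-L_n(\boldsymbol\beta)+\lambda_n^1\sum_{j=1}^Jw_1^{(j)}\|\boldsymbol\beta_j\|_2+\lambda_n^0\sum_{j=1}^J\sum_{0\le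 r<s\le p_j}w_0^{(j,rs)}\|\beta_{j,r}-\beta_{j,s}\|_0,$$ where $\lambda_n^1,\lambda_n^0\ge0$ are tuning parameters, $w_1^{(j)},w_0^{(j,rs)}$ are (possibly data-dependent) positive weights, and $\|t\|_0=0$ if $t=0$, $\|t\|_0=1$ if $t\ne0$ for $t\in\mathbb R$. Sparsity: the true underlying structure is sparse if, without loss of generality (after relabelling factors), the true active set $A^*=\{j:\boldsymbol\beta_j^*\ne\boldsymbol0\}$ can be written as $A^*=\{1,\dots,j_0\}$ with $j_0<J$. Regularity conditions. (Reg1) The density can be written as $f(\boldsymbol v,\boldsymbol\beta)=h(y)\exp(y\,\boldsymbol x^T\boldsymbol\beta-\varphi(\boldsymbol x^T\boldsymbol\beta))$; for binary logistic regression $h(y)=1$ and $\varphi(\eta)=\ln(1+\exp(\eta))$. (Reg2) The Fisher information matrix $\boldsymbol I_F(\boldsymbol\beta)$ is finite and positive definite at $\boldsymbol\beta=\boldsymbol\beta^*$, where $\boldsymbol I_F(\boldsymbol\beta^* )=\mathbb E(\varphi''(\boldsymbol x^T\boldsymbol\beta^* )\boldsymbol x\boldsymbol x^T)$. (Reg3) There is an open set $\mathcal O$ (depending on $n$) with $\boldsymbol\beta^*\in\mathcal O$ and a function $M(\boldsymbol x)\in\mathbb R$ such that for all $\boldsymbol\beta\in\mathcal O$: $|\varphi'''(\boldsymbol x^T\boldsymbol\beta)|\le M(\boldsymbol x)<\infty$, and $\mathbb E(M(\boldsymbol x)|x_jx_kx_l|)<\infty$ for all $1\le j,k,l\le p$.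 $\to_P$ denotes convergence in probability as $n\to\infty$.
   Formalization: The maximum a_n^0 is taken over 0≤r<s≤p_j (the pairs of the penalty) instead of 1≤r<s≤p_j; the L_0-FGL estimator is required to minimize M_pen only for samples where a minimizer exists, and it is proved to be a minimizer with probability tending to 1. *)

theory Defs
  imports "HOL-Probability.Probability"
begin

text \<open>
  Vectors in the space of dimension \<open>1 + p 1 + \<dots> + p J\<close> are functions \<open>j k \<mapsto> \<beta> j k\<close> that vanish
  off the index set \<open>idx J p\<close>.  The intercept has index \<open>(0, 0)\<close>, and \<open>(j, k)\<close> is level \<open>k\<close> of
  factor \<open>j\<close>.  As \<open>(j, 0)\<close> with \<open>j \<ge> 1\<close> is not an index, the convention \<open>\<beta> j 0 = 0\<close> for the
  reference category is built in.
\<close>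

type_synonym vec = "nat \<Rightarrow> nat \<Rightarrow> real"
type_synonym obs = "real \<times> vec"  \<comment> \<open>an observation \<open>(y, x)\<close>\<close>

definition dummy_idx :: "nat \<Rightarrow> (nat \<Rightarrow> nat) \<Rightarrow> (nat \<times> nat) set" where
  "dummy_idx J p = (SIGMA j:{1..J}. {1..p j})"

definition idx :: "nat \<Rightarrow> (nat \<Rightarrow> nat) \<Rightarrow> (nat \<times> nat) set" where
  "idx J p = insert (0, 0) (dummy_idx J p)"

definition param_space :: "nat \<Rightarrow> (nat \<Rightarrow> nat) \<Rightarrow> vec set" where
  "param_space J p = {\<beta>. \<forall>j k. (j, k) \<notin> idx J p \<longrightarrow> \<beta> j k = 0}"

definition linpred :: "nat \<Rightarrow> (nat \<Rightarrow> nat) \<Rightarrow> vec \<Rightarrow> vec \<Rightarrow> real" where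
  "linpred J p x \<beta> = (\<Sum>(j, k)\<in>idx J p. x j k * \<beta> j k)"

definition dummy_coding :: "nat \<Rightarrow> (nat \<Rightarrow> nat) \<Rightarrow> (nat \<Rightarrow> nat) \<Rightarrow> vec" where
  "dummy_coding J p c = (\<lambda>j k.
     if (j, k) = (0, 0) then 1
     else if (j, k) \<in> dummy_idx J p \<and> c j = k then 1 else 0)"

definition design_space :: "nat \<Rightarrow> (nat \<Rightarrow> nat) \<Rightarrow> vec set" where
  "design_space J p = dummy_coding J p ` (\<Pi>\<^sub>E j\<in>{1..J}. {0..p j})"

text \<open>
  The sample space is finite.  It carries the discrete sigma-algebra, so every function of a
  sample is automatically measurable.
\<close>

definition obs_space :: "nat \<Rightarrow> (nat \<Rightarrow> nat) \<Rightarrow> obs set" where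
  "obs_space J p = {0, 1} \<times> design_space J p"

definition samples :: "nat \<Rightarrow> (nat \<Rightarrow> nat) \<Rightarrow> nat \<Rightarrow> obs list set" where
  "samples J p n = {vs \<in> lists (obs_space J p). length vs = n}"

definition sample :: "(nat \<Rightarrow> 'a \<Rightarrow> obs) \<Rightarrow> nat \<Rightarrow> 'a \<Rightarrow> obs list" where
  "sample V n \<omega> = map (\<lambda>i. V i \<omega>) [1..<Suc n]"

definition iid_copies ::
  "nat \<Rightarrow> (nat \<Rightarrow> nat) \<Rightarrow> 'a measure \<Rightarrow> (nat \<Rightarrow> 'a \<Rightarrow> obs) \<Rightarrow> obs measure \<Rightarrow> bool" where
  "iid_copies J p M V D \<longleftrightarrow>
     prob_space.indep_vars M (\<lambda>_. count_space (obs_space J p)) V {1..} \<and>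
     (\<forall>i\<ge>1. distr M (count_space (obs_space J p)) (V i) = D)"

definition logistic_mean :: "real \<Rightarrow> real" where
  "logistic_mean \<eta> = exp \<eta> / (1 + exp \<eta>)"

text \<open>\<open>D\<close> is the law of \<open>(y, x)\<close>; the conditional expectation is given the sigma-algebra of \<open>x\<close>.\<close>

definition logistic_model ::
  "nat \<Rightarrow> (nat \<Rightarrow> nat) \<Rightarrow> obs measure \<Rightarrow> vec \<Rightarrow> bool" where
  "logistic_model J p D \<beta> \<longleftrightarrow>
     (AE v in D.
        real_cond_exp D (vimage_algebra (space D) snd (count_space (design_space J p))) fst v
        = logistic_mean (linpred J p (snd v) \<beta>))"

text \<open>
  Conditional (Bernoulli) density of \<open>y\<close> given \<open>x\<close> under parameter \<open>\<beta>\<close>; the factor from the law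
  of \<open>x\<close>, which does not involve \<open>\<beta>\<close>, is omitted.
\<close>

definition density_f :: "nat \<Rightarrow> (nat \<Rightarrow> nat) \<Rightarrow> obs \<Rightarrow> vec \<Rightarrow> real" where
  "density_f J p v \<beta> =
     (if fst v = 1 then logistic_mean (linpred J p (snd v) \<beta>)
      else 1 - logistic_mean (linpred J p (snd v) \<beta>))"

definition log_lik :: "nat \<Rightarrow> (nat \<Rightarrow> nat) \<Rightarrow> obs list \<Rightarrow> vec \<Rightarrow> real" where
  "log_lik J p vs \<beta> = (\<Sum>v\<leftarrow>vs. ln (density_f J p v \<beta>))"

definition phi :: "real \<Rightarrow> real" where
  "phi \<eta> = ln (1 + exp \<eta>)"

definition base_h :: "real \<Rightarrow> real" where
  "base_h y = 1"

definition reg1 :: "nat \<Rightarrow> (nat \<Rightarrow> nat) \<Rightarrow> bool" where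
  "reg1 J p \<longleftrightarrow>
     (\<forall>v\<in>obs_space J p. \<forall>\<beta>\<in>param_space J p.
        density_f J p v \<beta> =
        base_h (fst v) * exp (fst v * linpred J p (snd v) \<beta> - phi (linpred J p (snd v) \<beta>)))"

definition fisher_integrand ::
  "nat \<Rightarrow> (nat \<Rightarrow> nat) \<Rightarrow> vec \<Rightarrow> nat \<times> nat \<Rightarrow> nat \<times> nat \<Rightarrow> obs \<Rightarrow> real" where
  "fisher_integrand J p \<beta> a b v =
     (deriv ^^ 2) phi (linpred J p (snd v) \<beta>) * case_prod (snd v) a * case_prod (snd v) b"

definition fisher ::
  "nat \<Rightarrow> (nat \<Rightarrow> nat) \<Rightarrow> obs measure \<Rightarrow> vec \<Rightarrow> nat \<times> nat \<Rightarrow> nat \<times> nat \<Rightarrow> real" where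
  "fisher J p D \<beta> a b = (\<integral>v. fisher_integrand J p \<beta> a b v \<partial>D)"

definition reg2 :: "nat \<Rightarrow> (nat \<Rightarrow> nat) \<Rightarrow> obs measure \<Rightarrow> vec \<Rightarrow> bool" where
  "reg2 J p D \<beta> \<longleftrightarrow>
     (\<forall>a\<in>idx J p. \<forall>b\<in>idx J p. integrable D (fisher_integrand J p \<beta> a b)) \<and>
     (\<forall>u\<in>param_space J p. u \<noteq> (\<lambda>_ _. 0) \<longrightarrow>
        (\<Sum>a\<in>idx J p. \<Sum>b\<in>idx J p.
           case_prod u a * fisher J p D \<beta> a b * case_prod u b) > 0)"

text \<open>
  The topology on \<open>vec\<close> is the product topology; on \<open>param_space J p\<close>, where only finitely many
  coordinates are free, it induces the Euclidean topology.
\<close>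

definition reg3 :: "nat \<Rightarrow> (nat \<Rightarrow> nat) \<Rightarrow> obs measure \<Rightarrow> vec \<Rightarrow> bool" where
  "reg3 J p D \<beta>\<^sub>0 \<longleftrightarrow>
     (\<exists>(U :: nat \<Rightarrow> vec set) (B :: vec \<Rightarrow> real).
        (\<forall>n. openin (top_of_set (param_space J p)) (U n) \<and> \<beta>\<^sub>0 \<in> U n \<and>
             (\<forall>\<beta>\<in>U n. \<forall>x\<in>design_space J p. \<bar>(deriv ^^ 3) phi (linpred J p x \<beta>)\<bar> \<le> B x)) \<and>
        (\<forall>a\<in>dummy_idx J p. \<forall>b\<in>dummy_idx J p. \<forall>c\<in>dummy_idx J p.
           integrable D (\<lambda>v. B (snd v) *
             \<bar>case_prod (snd v) a * case_prod (snd v) b * case_prod (snd v) c\<bar>)))"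

definition level_pairs :: "nat \<Rightarrow> (nat \<times> nat) set" where
  "level_pairs m = {(r, s). r < s \<and> s \<le> m}"

definition M_pen ::
  "nat \<Rightarrow> (nat \<Rightarrow> nat) \<Rightarrow> real \<Rightarrow> real \<Rightarrow> (nat \<Rightarrow> real) \<Rightarrow> (nat \<Rightarrow> nat \<Rightarrow> nat \<Rightarrow> real) \<Rightarrow>
   obs list \<Rightarrow> vec \<Rightarrow> real" where
  "M_pen J p l1 l0 w1 w0 vs \<beta> =
     - log_lik J p vs \<beta>
     + l1 * (\<Sum>j\<in>{1..J}. w1 j * L2_set (\<beta> j) {1..p j})
     + l0 * (\<Sum>j\<in>{1..J}. \<Sum>(r, s)\<in>level_pairs (p j). w0 j r s * of_bool (\<beta> j r - \<beta> j s \<noteq> 0))"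

definition is_minimizer ::
  "nat \<Rightarrow> (nat \<Rightarrow> nat) \<Rightarrow> real \<Rightarrow> real \<Rightarrow> (nat \<Rightarrow> real) \<Rightarrow> (nat \<Rightarrow> nat \<Rightarrow> nat \<Rightarrow> real) \<Rightarrow>
   obs list \<Rightarrow> vec \<Rightarrow> bool" where
  "is_minimizer J p l1 l0 w1 w0 vs \<beta> \<longleftrightarrow>
     is_arg_min (M_pen J p l1 l0 w1 w0 vs) (\<lambda>\<beta>. \<beta> \<in> param_space J p) \<beta>"

text \<open>
  An estimator is a function of the sample.  For some samples (e.g. all responses equal to 1) the
  infimum of \<open>M_pen\<close> is not attained; only there is the value of the estimator arbitrary.
  The weights may depend on the sample.
\<close>

definition L0_FGL_estimator ::
  "nat \<Rightarrow> (nat \<Rightarrow> nat) \<Rightarrow> nat \<Rightarrow> real \<Rightarrow> real \<Rightarrow> (obs list \<Rightarrow> nat \<Rightarrow> real) \<Rightarrow>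
   (obs list \<Rightarrow> nat \<Rightarrow> nat \<Rightarrow> nat \<Rightarrow> real) \<Rightarrow> (obs list \<Rightarrow> vec) \<Rightarrow> bool" where
  "L0_FGL_estimator J p n l1 l0 w1 w0 \<beta>h \<longleftrightarrow>
     (\<forall>vs\<in>samples J p n.
        \<beta>h vs \<in> param_space J p \<and>
        ((\<exists>\<beta>. is_minimizer J p l1 l0 (w1 vs) (w0 vs) vs \<beta>) \<longrightarrow>
         is_minimizer J p l1 l0 (w1 vs) (w0 vs) vs (\<beta>h vs)))"

definition a1 :: "nat \<Rightarrow> real \<Rightarrow> (nat \<Rightarrow> real) \<Rightarrow> real" where
  "a1 J l1 w1 = Max ((\<lambda>j. l1 * w1 j) ` {1..J})"

text \<open>
  The maximum runs over the same pairs as the penalty, hence includes the pairs \<open>(0, s)\<close> with the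
  reference level: if their weights were unconstrained, they could force all coefficients to 0.
\<close>

definition a0 :: "nat \<Rightarrow> (nat \<Rightarrow> nat) \<Rightarrow> real \<Rightarrow> (nat \<Rightarrow> nat \<Rightarrow> nat \<Rightarrow> real) \<Rightarrow> real" where
  "a0 J p l0 w0 = Max ((\<lambda>(j, r, s). l0 * w0 j r s) ` (SIGMA j:{1..J}. level_pairs (p j)))"

definition active_set :: "nat \<Rightarrow> (nat \<Rightarrow> nat) \<Rightarrow> vec \<Rightarrow> nat set" where
  "active_set J p \<beta> = {j \<in> {1..J}. \<exists>k\<in>{1..p j}. \<beta> j k \<noteq> 0}"

text \<open>\<open>\<pi>\<close> is the relabelling of the factors.\<close>

definition sparse_structure :: "nat \<Rightarrow> (nat \<Rightarrow> nat) \<Rightarrow> vec \<Rightarrow> bool" where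
  "sparse_structure J p \<beta> \<longleftrightarrow>
     (\<exists>\<pi> j0. bij_betw \<pi> {1..J} {1..J} \<and> j0 < J \<and> \<pi> ` active_set J p \<beta> = {1..j0})"

definition conv_in_prob :: "'a measure \<Rightarrow> (nat \<Rightarrow> 'a \<Rightarrow> real) \<Rightarrow> real \<Rightarrow> bool" where
  "conv_in_prob M X c \<longleftrightarrow>
     (\<forall>n. X n \<in> borel_measurable M) \<and>
     (\<forall>\<epsilon>>0. (\<lambda>n. measure M {\<omega> \<in> space M. \<bar>X n \<omega> - c\<bar> > \<epsilon>}) \<longlonglongrightarrow> 0)"

end

theory Submission
  imports Defs
begin

text \<open>
  The estimator is consistent, and consistency forces the nonzero coefficients of the true
  parameter \<open>\<beta>s\<close> to stay nonzero.  The argument is quantitative.  Write the log likelihood ratio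
  between \<open>\<beta>s\<close> and a competitor \<open>\<beta>\<close> as a sum over the finitely many design points \<open>x\<close>
  (\<open>log_lik_diff\<close>): each point contributes the number of its observations times a Bregman
  divergence of \<open>phi\<close>, minus its residual sum times the difference of the linear predictors.

  The divergence grows at least linearly in the difference of the predictors
  (\<open>phi_bregman_lower_bound\<close>).  Positive definiteness of the Fisher information makes the expected
  absolute predictor a norm on the parameter space (\<open>fisher_positive_definite_identifies\<close>,
  \<open>weighted_linpred_dominates_l1_norm\<close>).  By the law of large numbers the design frequencies approach
  the population frequencies, and the residual sums are \<open>o n\<close> because residuals have mean 0 under
  the model (\<open>logistic_model_score_mean\<close>).  Hence, with probability tending to 1, every \<open>\<beta>\<close> at
  distance at least \<open>\<delta>\<close> from \<open>\<beta>s\<close> has a log likelihood smaller by at least \<open>c n\<close>, where \<open>c > 0\<close> does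
  not depend on \<open>\<beta>\<close> (\<open>log_lik_gap\<close>).

  The penalties are nonnegative, and at \<open>\<beta>s\<close> their sum is at most a multiple of \<open>sqrt n\<close> plus a
  constant, again with probability tending to 1 (\<open>penalty_le\<close>).  So eventually no such \<open>\<beta>\<close> can beat
  \<open>\<beta>s\<close>.  A minimizer over the closed ball of radius \<open>\<delta>\<close>, which exists by compactness and lower
  semicontinuity, is therefore a global one, and all global minimizers lie within \<open>\<delta>\<close> of \<open>\<beta>s\<close>
  (\<open>M_pen_minimizer_near\<close>).  Taking for \<open>\<delta>\<close> a lower bound of the nonzero coefficients of \<open>\<beta>s\<close> in
  absolute value gives the inclusion of active sets.
\<close>

section \<open>The cumulant function of the logistic model\<close>

text \<open>
  This is convexity of \<open>phi\<close>, obtained without derivatives: with \<open>q = logistic_mean \<xi>\<close> the quotient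
  \<open>(1 + exp \<eta>) / (1 + exp \<xi>)\<close> is the average of \<open>exp 0\<close> and \<open>exp (\<eta> - \<xi>)\<close> with weights \<open>1 - q\<close> and
  \<open>q\<close>, to which Jensen's inequality for \<open>exp\<close> applies; then take logarithms.
\<close>

lemma phi_above_tangent: "phi \<xi> + logistic_mean \<xi> * (\<eta> - \<xi>) \<le> phi \<eta>"
proof -
  define q where "q = logistic_mean \<xi>"
  have pos: "1 + exp t > 0" for t :: real
    by (simp add: add_pos_pos)
  have q: "0 \<le> q" "q \<le> 1" "1 - q = 1 / (1 + exp \<xi>)"
    using pos[of \<xi>] by (auto simp: q_def logistic_mean_def field_simps)
  have "exp (q * (\<eta> - \<xi>)) \<le> (1 - q) * exp 0 + q * exp (\<eta> - \<xi>)"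
    using convex_onD[OF convex_on_exp[of 1], of q 0 "\<eta> - \<xi>"] q by simp
  also have "\<dots> = (1 + exp \<eta>) / (1 + exp \<xi>)"
    unfolding q(3) using pos[of \<xi>]
    by (simp add: q_def logistic_mean_def exp_diff add_divide_distrib)
  finally have "ln (exp (q * (\<eta> - \<xi>))) \<le> ln ((1 + exp \<eta>) / (1 + exp \<xi>))"
    using pos by (subst ln_le_cancel_iff) auto
  then show ?thesis
    using pos[of \<xi>] pos[of \<eta>] by (simp add: ln_div phi_def q_def split: if_splits)
qed

lemma strict_mono_logistic_mean: "strict_mono logistic_mean"
proof (rule strict_monoI)
  fix a b :: real assume "a < b"
  then have "exp a < exp b" by simp
  then show "logistic_mean a < logistic_mean b"
    unfolding logistic_mean_def
    by (subst divide_less_eq, simp add: add_pos_pos) (simp add: field_simps add_pos_pos)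
qed

definition phi_bregman :: "real \<Rightarrow> real \<Rightarrow> real" where
  "phi_bregman a b = phi b - phi a - logistic_mean a * (b - a)"

lemma phi_bregman_nonneg: "phi_bregman a b \<ge> 0"
  using phi_above_tangent[of a b] by (simp add: phi_bregman_def)

text \<open>
  The divergence from \<open>a\<close> is bounded below by its tangents at \<open>a + \<delta>\<close> and \<open>a - \<delta>\<close>, whose slopes are
  nonzero by strict monotonicity of the logistic function.  A linear bound, as opposed to a
  quadratic one near \<open>a\<close>, is what holds for all real \<open>\<eta>\<close>; it therefore controls parameters
  arbitrarily far away.
\<close>

lemma phi_bregman_lower_bound:
  assumes "\<delta> > 0"
  shows "\<exists>b>0. \<forall>\<eta>. phi_bregman a \<eta> \<ge> b * (\<bar>\<eta> - a\<bar> - \<delta>)"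
proof -
  define b1 where "b1 = logistic_mean (a + \<delta>) - logistic_mean a"
  define b2 where "b2 = logistic_mean a - logistic_mean (a - \<delta>)"
  define b where "b = min b1 b2"
  have "b1 > 0" "b2 > 0"
    using assms strict_mono_logistic_mean by (auto simp: b1_def b2_def strict_mono_less)
  then have "b > 0" by (simp add: b_def)
  have "phi_bregman a \<eta> \<ge> b * (\<bar>\<eta> - a\<bar> - \<delta>)" for \<eta>
  proof (cases "\<bar>\<eta> - a\<bar> < \<delta>")
    case True
    then show ?thesis
      using phi_bregman_nonneg[of a \<eta>] \<open>b > 0\<close> mult_pos_neg[of b "\<bar>\<eta> - a\<bar> - \<delta>"] by linarith
  next
    case far: False
    show ?thesis
    proof (cases "\<eta> \<ge> a")
      case True
      have "b * (\<bar>\<eta> - a\<bar> - \<delta>) \<le> b1 * (\<bar>\<eta> - a\<bar> - \<delta>)"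
        using far by (intro mult_right_mono) (auto simp: b_def)
      also have "\<dots> = b1 * (\<eta> - (a + \<delta>))" using True by simp
      also have "\<dots> \<le> phi_bregman a \<eta>"
        using phi_above_tangent[of "a + \<delta>" \<eta>] phi_above_tangent[of a "a + \<delta>"]
        by (simp add: phi_bregman_def b1_def algebra_simps)
      finally show ?thesis .
    next
      case False
      have "b * (\<bar>\<eta> - a\<bar> - \<delta>) \<le> b2 * (\<bar>\<eta> - a\<bar> - \<delta>)"
        using far by (intro mult_right_mono) (auto simp: b_def)
      also have "\<dots> = b2 * ((a - \<delta>) - \<eta>)" using False by simp
      also have "\<dots> \<le> phi_bregman a \<eta>"
        using phi_above_tangent[of "a - \<delta>" \<eta>] phi_above_tangent[of a "a - \<delta>"]
        by (simp add: phi_bregman_def b2_def algebra_simps)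
      finally show ?thesis .
    qed
  qed
  with \<open>b > 0\<close> show ?thesis by blast
qed

lemma phi_bregman_lower_bound_uniform:
  assumes "\<delta> > 0" "finite X"
  shows "\<exists>b>0. \<forall>a\<in>X. \<forall>\<eta>. phi_bregman a \<eta> \<ge> b * (\<bar>\<eta> - a\<bar> - \<delta>)"
  using assms(2)
proof (induction X rule: finite_induct)
  case empty
  show ?case by (intro exI[of _ 1]) auto
next
  case (insert c X)
  obtain b where b: "b > 0" "\<And>a \<eta>. a \<in> X \<Longrightarrow> phi_bregman a \<eta> \<ge> b * (\<bar>\<eta> - a\<bar> - \<delta>)"
    using insert.IH by blast
  obtain b' where b': "b' > 0" "\<And>\<eta>. phi_bregman c \<eta> \<ge> b' * (\<bar>\<eta> - c\<bar> - \<delta>)"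
    using phi_bregman_lower_bound[OF assms(1)] by blast
  have weaken: "min b b' * (t - \<delta>) \<le> B"
    if "(b * (t - \<delta>) \<le> B \<or> b' * (t - \<delta>) \<le> B)" "0 \<le> B" for t B
  proof (cases "t \<ge> \<delta>")
    case True
    then have "min b b' * (t - \<delta>) \<le> b * (t - \<delta>)" "min b b' * (t - \<delta>) \<le> b' * (t - \<delta>)"
      by (intro mult_right_mono; simp)+
    with that show ?thesis by linarith
  next
    case False
    then have "min b b' * (t - \<delta>) \<le> 0"
      using b(1) b'(1) by (intro mult_nonneg_nonpos) auto
    with that show ?thesis by linarith
  qed
  show ?case
    using b b' weaken phi_bregman_nonneg by (intro exI[of _ "min b b'"]) auto
qed

section \<open>Linear predictors and the norm on the parameter space\<close>

lemma finite_dummy_idx [simp]: "finite (dummy_idx J p)"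
  by (simp add: dummy_idx_def)

lemma finite_idx [simp]: "finite (idx J p)"
  by (simp add: idx_def)

lemma finite_design_space [simp]: "finite (design_space J p)"
  by (simp add: design_space_def finite_PiE)

lemma finite_obs_space [simp]: "finite (obs_space J p)"
  by (simp add: obs_space_def)

lemma design_space_bounded: "x \<in> design_space J p \<Longrightarrow> 0 \<le> x j k \<and> x j k \<le> 1"
  by (auto simp: design_space_def dummy_coding_def)

lemma linpred_altdef: "linpred J p x \<beta> = (\<Sum>a\<in>idx J p. case_prod x a * case_prod \<beta> a)"
  unfolding linpred_def by (intro sum.cong) auto

definition l1_norm :: "nat \<Rightarrow> (nat \<Rightarrow> nat) \<Rightarrow> vec \<Rightarrow> real" where
  "l1_norm J p u = (\<Sum>a\<in>idx J p. \<bar>case_prod u a\<bar>)"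

lemma l1_norm_nonneg: "l1_norm J p u \<ge> 0"
  by (auto simp: l1_norm_def intro: sum_nonneg)

lemma coordinate_le_l1_norm: "(j, k) \<in> idx J p \<Longrightarrow> \<bar>u j k\<bar> \<le> l1_norm J p u"
  unfolding l1_norm_def
  using member_le_sum[of "(j, k)" "idx J p" "\<lambda>a. \<bar>case_prod u a\<bar>"] by simp

lemma linpred_diff:
  "linpred J p x \<beta> - linpred J p x \<gamma> = linpred J p x (\<lambda>j k. \<beta> j k - \<gamma> j k)"
  unfolding linpred_altdef sum_subtractf[symmetric]
  by (intro sum.cong) (auto simp: algebra_simps)

lemma linpred_scale: "linpred J p x (\<lambda>j k. c * \<beta> j k) = c * linpred J p x \<beta>"
  unfolding linpred_altdef sum_distrib_left by (intro sum.cong) auto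

lemma linpred_le_l1_norm:
  assumes "x \<in> design_space J p"
  shows "\<bar>linpred J p x u\<bar> \<le> l1_norm J p u"
proof -
  have "\<bar>linpred J p x u\<bar> \<le> (\<Sum>a\<in>idx J p. \<bar>case_prod x a * case_prod u a\<bar>)"
    unfolding linpred_altdef by (rule sum_abs)
  also have "\<dots> \<le> l1_norm J p u"
    unfolding l1_norm_def
  proof (rule sum_mono)
    fix a assume "a \<in> idx J p"
    obtain j k where a: "a = (j, k)" by force
    show "\<bar>case_prod x a * case_prod u a\<bar> \<le> \<bar>case_prod u a\<bar>"
      using design_space_bounded[OF assms, of j k]
      by (simp add: a abs_mult mult_left_le_one_le)
  qed
  finally show ?thesis .
qed

lemma diff_in_param_space:
  "\<beta> \<in> param_space J p \<Longrightarrow> \<gamma> \<in> param_space J p \<Longrightarrow> (\<lambda>j k. \<beta> j k - \<gamma> j k) \<in> param_space J p"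
  by (auto simp: param_space_def)

lemma continuous_on_coordinate [continuous_intros]:
  "continuous_on S (\<lambda>u::vec. u j k)"
proof -
  have "continuous_on S (\<lambda>u::vec. u j)"
    by (rule continuous_on_subset[OF continuous_on_product_coordinates]) auto
  from continuous_on_product_then_coordinatewise[OF this] show ?thesis .
qed

lemma continuous_on_linpred [continuous_intros]: "continuous_on S (\<lambda>u. linpred J p x u)"
  unfolding linpred_def case_prod_unfold by (intro continuous_intros)

lemma continuous_on_l1_norm [continuous_intros]:
  "continuous_on S (\<lambda>u. l1_norm J p (\<lambda>j k. u j k - c j k))"
  unfolding l1_norm_def case_prod_unfold by (intro continuous_intros)

text \<open>
  Tychonoff's theorem in the type class setting; \<open>vec\<close> is an iterated function type, so it is used
  once for the outer and once for the inner argument.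
\<close>

lemma compact_PiE_UNIV:
  fixes S :: "'i \<Rightarrow> 'b::topological_space set"
  assumes "\<And>i. compact (S i)"
  shows "compact (PiE UNIV S)"
  using compactin_PiE[of "\<lambda>_. euclidean" UNIV S] assms
  by (simp add: euclidean_product_topology)

lemma compact_l1_ball:
  "compact {u \<in> param_space J p. l1_norm J p (\<lambda>j k. u j k - c j k) \<le> R}"
    (is "compact ?B")
proof -
  define S where "S = (\<lambda>j k. if (j, k) \<in> idx J p then {c j k - R..c j k + R} else {0::real})"
  have "compact (PiE UNIV (\<lambda>j. PiE UNIV (S j)))" (is "compact ?C")
    by (intro compact_PiE_UNIV) (auto simp: S_def)
  moreover have "closed {u. l1_norm J p (\<lambda>j k. u j k - c j k) \<le> R}" (is "closed ?D")
    by (intro closed_Collect_le continuous_intros) 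
  moreover have "?B = ?C \<inter> ?D"
  proof (intro equalityI subsetI)
    fix u assume u: "u \<in> ?B"
    have "u j k \<in> S j k" for j k
      using u coordinate_le_l1_norm[of j k J p "\<lambda>j k. u j k - c j k"]
      by (auto simp: S_def param_space_def abs_le_iff)
    then show "u \<in> ?C \<inter> ?D" using u by (auto simp: PiE_def)
  next
    fix u assume u: "u \<in> ?C \<inter> ?D"
    have "u j k = 0" if "(j, k) \<notin> idx J p" for j k
    proof -
      have "u j k \<in> S j k" using u by (auto simp: PiE_def Pi_def)
      with that show ?thesis by (simp add: S_def)
    qed
    then show "u \<in> ?B" using u by (auto simp: param_space_def)
  qed
  ultimately show ?thesis by (simp add: compact_Int_closed)
qed

text \<open>
  Equivalence of norms in finite dimension: the weighted sum is positive and continuous, hence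
  bounded away from 0 on the compact unit sphere, and both sides are homogeneous.
\<close>

lemma weighted_linpred_dominates_l1_norm:
  assumes nonneg: "\<And>x. x \<in> X \<Longrightarrow> P x \<ge> 0"
    and pos: "\<And>u. u \<in> param_space J p \<Longrightarrow> u \<noteq> (\<lambda>_ _. 0) \<Longrightarrow> (\<Sum>x\<in>X. P x * \<bar>linpred J p x u\<bar>) > 0"
  shows "\<exists>\<kappa>>0. \<forall>u\<in>param_space J p. \<kappa> * l1_norm J p u \<le> (\<Sum>x\<in>X. P x * \<bar>linpred J p x u\<bar>)"
proof -
  define T where "T = (\<lambda>u. \<Sum>x\<in>X. P x * \<bar>linpred J p x u\<bar>)"
  define S where "S = {u \<in> param_space J p. l1_norm J p u = 1}"
  have norm_cont: "continuous_on UNIV (\<lambda>u. l1_norm J p u)"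
    using continuous_on_l1_norm[of UNIV J p "\<lambda>_ _. 0"] by simp
  have "S = {u \<in> param_space J p. l1_norm J p (\<lambda>j k. u j k - 0) \<le> 1} \<inter> {u. l1_norm J p u = 1}"
    by (auto simp: S_def)
  moreover have "closed {u. l1_norm J p u = 1}"
    by (intro closed_Collect_eq norm_cont continuous_intros)
  ultimately have "compact S"
    using compact_l1_ball[of J p "\<lambda>_ _. 0" 1] by (simp only: compact_Int_closed)
  define e :: vec where "e = (\<lambda>j k. of_bool (j = 0 \<and> k = 0))"
  have "l1_norm J p e = (\<Sum>a\<in>idx J p. if a = (0, 0) then 1 else 0)"
    unfolding l1_norm_def by (intro sum.cong) (auto simp: e_def)
  also have "\<dots> = 1" by (simp add: idx_def)
  finally have "e \<in> S"
    by (auto simp: S_def e_def param_space_def idx_def)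
  have "continuous_on S T" unfolding T_def by (intro continuous_intros)
  then obtain u0 where u0: "u0 \<in> S" "\<And>u. u \<in> S \<Longrightarrow> T u0 \<le> T u"
    using continuous_attains_inf[OF \<open>compact S\<close>] \<open>e \<in> S\<close> by blast
  have "u0 \<noteq> (\<lambda>_ _. 0)" using u0(1) by (auto simp: S_def l1_norm_def case_prod_unfold)
  then have "T u0 > 0" using u0(1) pos by (auto simp: S_def T_def)
  moreover have "T u0 * l1_norm J p u \<le> T u" if u: "u \<in> param_space J p" for u
  proof (cases "l1_norm J p u = 0")
    case True
    then show ?thesis using nonneg by (auto simp: T_def intro!: sum_nonneg)
  next
    case False
    define r where "r = l1_norm J p u"
    have "r > 0" using False l1_norm_nonneg[of J p u] by (simp add: r_def)
    define u' where "u' = (\<lambda>j k. (1 / r) * u j k)"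
    have "l1_norm J p u' = (1 / r) * r"
      unfolding l1_norm_def u'_def r_def sum_distrib_left
      by (intro sum.cong) (auto simp: abs_mult case_prod_unfold abs_of_nonneg sum_nonneg)
    then have "u' \<in> S" using u \<open>r > 0\<close> by (auto simp: S_def u'_def param_space_def)
    then have "T u0 \<le> T u'" by (rule u0)
    also have "T u' = (1 / r) * T u"
      unfolding T_def u'_def linpred_scale sum_distrib_left
      using \<open>r > 0\<close> by (intro sum.cong) (auto simp: abs_mult)
    finally show ?thesis using \<open>r > 0\<close> by (simp add: r_def[symmetric] field_simps)
  qed
  ultimately show ?thesis unfolding T_def by blast
qed

section \<open>Decomposition of the log likelihood by design point\<close>

text \<open>
  As the design space is finite, a sample enters the log likelihood ratio only through two
  statistics per design point: the number of observations there, and the sum of their residuals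
  \<open>y - E (y | x)\<close> under a reference parameter.
\<close>

definition design_count :: "obs list \<Rightarrow> vec \<Rightarrow> real" where
  "design_count vs x = (\<Sum>v\<leftarrow>vs. of_bool (snd v = x))"

definition design_score :: "nat \<Rightarrow> (nat \<Rightarrow> nat) \<Rightarrow> vec \<Rightarrow> obs list \<Rightarrow> vec \<Rightarrow> real" where
  "design_score J p \<beta> vs x =
     (\<Sum>v\<leftarrow>vs. of_bool (snd v = x) * (fst v - logistic_mean (linpred J p x \<beta>)))"

text \<open>
  The exponential family form gives \<open>ln f = y \<eta> - phi \<eta>\<close>, so subtracting the linear part of \<open>phi\<close> at
  the reference predictor leaves a nonnegative divergence and a term linear in the residuals.
\<close>

lemma log_lik_diff:
  assumes "reg1 J p" "vs \<in> lists (obs_space J p)"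
    and "\<beta> \<in> param_space J p" "\<gamma> \<in> param_space J p"
  shows "log_lik J p vs \<gamma> - log_lik J p vs \<beta> =
    (\<Sum>x\<in>design_space J p.
       design_count vs x * phi_bregman (linpred J p x \<gamma>) (linpred J p x \<beta>)
       - design_score J p \<gamma> vs x * (linpred J p x \<beta> - linpred J p x \<gamma>))"
  using assms(2)
proof (induction vs)
  case Nil
  then show ?case by (simp add: log_lik_def design_count_def design_score_def)
next
  case (Cons v vs)
  define D where "D = design_space J p"
  define \<xi> where "\<xi> = (\<lambda>x. linpred J p x \<gamma>)"
  define \<eta> where "\<eta> = (\<lambda>x. linpred J p x \<beta>)"
  have v: "v \<in> obs_space J p" "snd v \<in> D" using Cons by (auto simp: obs_space_def D_def)
  have ln_density: "ln (density_f J p v \<delta>) = fst v * linpred J p (snd v) \<delta> - phi (linpred J p (snd v) \<delta>)"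
    if "\<delta> \<in> param_space J p" for \<delta>
    using assms(1) that v(1) by (simp add: reg1_def base_h_def)
  have one: "(\<Sum>x\<in>D. of_bool (snd v = x) * g x) = g (snd v)" for g :: "vec \<Rightarrow> real"
    using v(2) by (simp add: D_def of_bool_def if_distrib if_distribR sum.delta cong: if_cong)
  have "(\<Sum>x\<in>D. design_count (v # vs) x * phi_bregman (\<xi> x) (\<eta> x)
           - design_score J p \<gamma> (v # vs) x * (\<eta> x - \<xi> x))
      = (\<Sum>x\<in>D. design_count vs x * phi_bregman (\<xi> x) (\<eta> x)
           - design_score J p \<gamma> vs x * (\<eta> x - \<xi> x))
        + (\<Sum>x\<in>D. of_bool (snd v = x) * (phi_bregman (\<xi> x) (\<eta> x)
             - (fst v - logistic_mean (\<xi> x)) * (\<eta> x - \<xi> x)))"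
    unfolding sum.distrib[symmetric] \<xi>_def \<eta>_def
    by (intro sum.cong) (auto simp: design_count_def design_score_def algebra_simps)
  also have "\<dots> = log_lik J p vs \<gamma> - log_lik J p vs \<beta>
        + (phi_bregman (\<xi> (snd v)) (\<eta> (snd v))
             - (fst v - logistic_mean (\<xi> (snd v))) * (\<eta> (snd v) - \<xi> (snd v)))"
    unfolding one using Cons by (simp add: D_def \<xi>_def \<eta>_def)
  also have "\<dots> = log_lik J p (v # vs) \<gamma> - log_lik J p (v # vs) \<beta>"
    using assms(3,4)
    by (simp add: log_lik_def ln_density phi_bregman_def \<xi>_def \<eta>_def algebra_simps)
  finally show ?case by (simp add: D_def \<xi>_def \<eta>_def)
qed

lemma design_count_nonneg: "design_count vs x \<ge> 0"
  by (auto simp: design_count_def intro!: sum_list_nonneg)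

lemma sum_design_count:
  assumes "vs \<in> lists (obs_space J p)"
  shows "(\<Sum>x\<in>design_space J p. design_count vs x) = real (length vs)"
  using assms
proof (induction vs)
  case (Cons v vs)
  then have "snd v \<in> design_space J p" by (auto simp: obs_space_def)
  then have "(\<Sum>x\<in>design_space J p. of_bool (snd v = x)) = (1::real)"
    by (simp add: of_bool_def sum.delta)
  with Cons show ?case by (simp add: design_count_def sum.distrib)
qed (simp add: design_count_def)

text \<open>
  When empirical frequencies are close to \<open>P\<close> and residual sums are small, the log likelihood drops
  linearly in the distance from \<open>\<gamma>\<close>: the divergences contribute at least \<open>b \<kappa>\<close> times the norm, up to
  the additive loss \<open>b \<tau>\<close>, while the sampling errors cost at most \<open>(1 + b) card X \<epsilon>\<close> times the norm.
  All errors are proportional to the same norm, so the bound is uniform over the unbounded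
  parameter space.
\<close>

lemma log_lik_gap:
  fixes b \<kappa> \<tau> \<epsilon> :: real
  assumes reg1: "reg1 J p" and vs: "vs \<in> samples J p n"
    and \<beta>: "\<beta> \<in> param_space J p" and \<gamma>: "\<gamma> \<in> param_space J p"
    and \<kappa>: "\<kappa> * l1_norm J p (\<lambda>j k. \<beta> j k - \<gamma> j k)
              \<le> (\<Sum>x\<in>design_space J p. P x * \<bar>linpred J p x \<beta> - linpred J p x \<gamma>\<bar>)"
    and b: "b \<ge> 0" "\<And>x \<eta>. x \<in> design_space J p \<Longrightarrow>
              phi_bregman (linpred J p x \<gamma>) \<eta> \<ge> b * (\<bar>\<eta> - linpred J p x \<gamma>\<bar> - \<tau>)"
    and count: "\<And>x. x \<in> design_space J p \<Longrightarrow> \<bar>design_count vs x - n * P x\<bar> \<le> n * \<epsilon>"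
    and score: "\<And>x. x \<in> design_space J p \<Longrightarrow> \<bar>design_score J p \<gamma> vs x\<bar> \<le> n * \<epsilon>"
  shows "log_lik J p vs \<gamma> - log_lik J p vs \<beta>
    \<ge> n * ((b * \<kappa> - (1 + b) * card (design_space J p) * \<epsilon>) * l1_norm J p (\<lambda>j k. \<beta> j k - \<gamma> j k) - b * \<tau>)"
proof -
  define X where "X = design_space J p"
  define N where "N = l1_norm J p (\<lambda>j k. \<beta> j k - \<gamma> j k)"
  define d where "d = (\<lambda>x. linpred J p x \<beta> - linpred J p x \<gamma>)"
  have d: "\<bar>d x\<bar> \<le> N" if "x \<in> X" for x
    unfolding d_def linpred_diff N_def using that by (intro linpred_le_l1_norm) (simp add: X_def)
  have vs': "vs \<in> lists (obs_space J p)" "length vs = n" using vs by (auto simp: samples_def)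
  have "n * (b * (P x * \<bar>d x\<bar>)) - b * (n * \<epsilon> * N) - b * (design_count vs x * \<tau>) - n * \<epsilon> * N
      \<le> design_count vs x * phi_bregman (linpred J p x \<gamma>) (linpred J p x \<beta>)
        - design_score J p \<gamma> vs x * d x" if x: "x \<in> X" for x
  proof -
    have "design_count vs x * (b * (\<bar>d x\<bar> - \<tau>))
          \<le> design_count vs x * phi_bregman (linpred J p x \<gamma>) (linpred J p x \<beta>)"
      using b(2)[of x "linpred J p x \<beta>"] x
      by (intro mult_left_mono design_count_nonneg) (auto simp: X_def d_def)
    moreover have "design_score J p \<gamma> vs x * d x \<le> (n * \<epsilon>) * N"
    proof -
      have "design_score J p \<gamma> vs x * d x \<le> \<bar>design_score J p \<gamma> vs x\<bar> * \<bar>d x\<bar>"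
        by (metis abs_ge_self abs_mult)
      also have "\<dots> \<le> (n * \<epsilon>) * N"
        using score[of x] d[OF x] x by (intro mult_mono) (auto simp: X_def intro: order_trans[OF abs_ge_zero])
      finally show ?thesis .
    qed
    moreover have "(n * P x - design_count vs x) * \<bar>d x\<bar> \<le> (n * \<epsilon>) * N"
    proof -
      have "(n * P x - design_count vs x) * \<bar>d x\<bar> \<le> \<bar>design_count vs x - n * P x\<bar> * \<bar>d x\<bar>"
        by (intro mult_right_mono) auto
      also have "\<dots> \<le> (n * \<epsilon>) * N"
        using count[of x] d[OF x] x by (intro mult_mono) (auto simp: X_def intro: order_trans[OF abs_ge_zero])
      finally show ?thesis .
    qed
    then have "b * ((n * P x - design_count vs x) * \<bar>d x\<bar>) \<le> b * ((n * \<epsilon>) * N)"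
      using b(1) by (intro mult_left_mono)
    ultimately show ?thesis by (simp add: algebra_simps)
  qed
  then have "(\<Sum>x\<in>X. n * (b * (P x * \<bar>d x\<bar>)) - b * (n * \<epsilon> * N) - b * (design_count vs x * \<tau>) - n * \<epsilon> * N)
      \<le> log_lik J p vs \<gamma> - log_lik J p vs \<beta>"
    unfolding log_lik_diff[OF reg1 vs'(1) \<beta> \<gamma>] X_def[symmetric]
    by (intro sum_mono) (simp add: d_def)
  moreover have "(\<Sum>x\<in>X. n * (b * (P x * \<bar>d x\<bar>)) - b * (n * \<epsilon> * N) - b * (design_count vs x * \<tau>) - n * \<epsilon> * N)
      = n * (b * (\<Sum>x\<in>X. P x * \<bar>d x\<bar>)) - card X * (b * (n * \<epsilon> * N))
         - b * ((\<Sum>x\<in>X. design_count vs x) * \<tau>) - card X * (n * \<epsilon> * N)"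
    by (simp add: sum_subtractf sum_distrib_left sum_distrib_right)
  moreover have "(\<Sum>x\<in>X. design_count vs x) = n"
    using sum_design_count[OF vs'(1)] vs'(2) by (simp add: X_def)
  moreover have "n * (b * (\<kappa> * N)) \<le> n * (b * (\<Sum>x\<in>X. P x * \<bar>d x\<bar>))"
    using \<kappa> b(1) by (intro mult_left_mono) (auto simp: N_def X_def d_def)
  ultimately show ?thesis
    unfolding N_def[symmetric] X_def[symmetric] by (simp add: algebra_simps)
qed

section \<open>The penalties\<close>

definition penalty ::
  "nat \<Rightarrow> (nat \<Rightarrow> nat) \<Rightarrow> real \<Rightarrow> real \<Rightarrow> (nat \<Rightarrow> real) \<Rightarrow> (nat \<Rightarrow> nat \<Rightarrow> nat \<Rightarrow> real) \<Rightarrow> vec \<Rightarrow> real" where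
  "penalty J p l1 l0 w1 w0 \<beta> =
     l1 * (\<Sum>j\<in>{1..J}. w1 j * L2_set (\<beta> j) {1..p j})
     + l0 * (\<Sum>j\<in>{1..J}. \<Sum>(r, s)\<in>level_pairs (p j). w0 j r s * of_bool (\<beta> j r - \<beta> j s \<noteq> 0))"

lemma M_pen_altdef: "M_pen J p l1 l0 w1 w0 vs \<beta> = - log_lik J p vs \<beta> + penalty J p l1 l0 w1 w0 \<beta>"
  by (simp add: M_pen_def penalty_def)

lemma finite_level_pairs [simp]: "finite (level_pairs m)"
  by (rule finite_subset[of _ "{..m} \<times> {..m}"]) (auto simp: level_pairs_def)

lemma penalty_nonneg:
  assumes "l1 \<ge> 0" "l0 \<ge> 0"
    and "\<And>j. j \<in> {1..J} \<Longrightarrow> w1 j > 0"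
    and "\<And>j r s. j \<in> {1..J} \<Longrightarrow> (r, s) \<in> level_pairs (p j) \<Longrightarrow> w0 j r s > 0"
  shows "penalty J p l1 l0 w1 w0 \<beta> \<ge> 0"
  unfolding penalty_def
proof (intro add_nonneg_nonneg mult_nonneg_nonneg assms sum_nonneg)
  fix j assume j: "j \<in> {1..J}"
  show "w1 j \<ge> 0" using assms(3)[OF j] by simp
  show "(case e of (r, s) \<Rightarrow> w0 j r s * of_bool (\<beta> j r - \<beta> j s \<noteq> 0)) \<ge> 0"
    if "e \<in> level_pairs (p j)" for e
    using assms(4)[OF j] that by (cases e) (auto intro!: mult_nonneg_nonneg less_imp_le)
qed auto

text \<open>
  The penalty at a fixed parameter is of the order of the weight maxima, hence \<open>o (sqrt n)\<close> plus a
  stochastically bounded term when these behave as assumed in the theorem.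
\<close>

lemma penalty_le:
  assumes "l1 \<ge> 0" "l0 \<ge> 0"
    and "\<And>j r s. j \<in> {1..J} \<Longrightarrow> (r, s) \<in> level_pairs (p j) \<Longrightarrow> w0 j r s > 0"
  shows "penalty J p l1 l0 w1 w0 \<beta> \<le>
           a1 J l1 w1 * (\<Sum>j\<in>{1..J}. L2_set (\<beta> j) {1..p j})
           + a0 J p l0 w0 * real (\<Sum>j\<in>{1..J}. card (level_pairs (p j)))"
proof -
  have "l1 * (\<Sum>j\<in>{1..J}. w1 j * L2_set (\<beta> j) {1..p j})
          = (\<Sum>j\<in>{1..J}. (l1 * w1 j) * L2_set (\<beta> j) {1..p j})"
    by (simp add: sum_distrib_left mult.assoc)
  also have "\<dots> \<le> (\<Sum>j\<in>{1..J}. a1 J l1 w1 * L2_set (\<beta> j) {1..p j})"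
    unfolding a1_def by (intro sum_mono mult_right_mono Max_ge) auto
  finally have 1: "l1 * (\<Sum>j\<in>{1..J}. w1 j * L2_set (\<beta> j) {1..p j})
                     \<le> a1 J l1 w1 * (\<Sum>j\<in>{1..J}. L2_set (\<beta> j) {1..p j})"
    by (simp add: sum_distrib_left)
  have le_a0: "l0 * w0 j r s \<le> a0 J p l0 w0" if "j \<in> {1..J}" "(r, s) \<in> level_pairs (p j)" for j r s
    unfolding a0_def by (rule Max_ge) (use that in \<open>auto intro!: image_eqI[of _ _ "(j, r, s)"]\<close>)
  have "l0 * (\<Sum>j\<in>{1..J}. \<Sum>(r, s)\<in>level_pairs (p j). w0 j r s * of_bool (\<beta> j r - \<beta> j s \<noteq> 0))
        = (\<Sum>j\<in>{1..J}. \<Sum>(r, s)\<in>level_pairs (p j). (l0 * w0 j r s) * of_bool (\<beta> j r - \<beta> j s \<noteq> 0))"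
    by (simp add: sum_distrib_left case_prod_unfold mult.assoc del: sum_mult_of_bool_eq)
  also have "\<dots> \<le> (\<Sum>j\<in>{1..J}. \<Sum>(r, s)\<in>level_pairs (p j). a0 J p l0 w0)"
  proof (intro sum_mono, clarify)
    fix j r s assume jrs: "j \<in> {1..J}" "(r, s) \<in> level_pairs (p j)"
    have "0 \<le> l0 * w0 j r s"
      using assms(2) assms(3)[OF jrs] by simp
    then show "l0 * w0 j r s * of_bool (\<beta> j r - \<beta> j s \<noteq> 0) \<le> a0 J p l0 w0"
      using le_a0[OF jrs] by auto
  qed
  also have "\<dots> = a0 J p l0 w0 * real (\<Sum>j\<in>{1..J}. card (level_pairs (p j)))"
    by (simp add: sum_distrib_left case_prod_unfold mult.commute)
  finally show ?thesis
    using 1 by (simp add: penalty_def)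
qed

section \<open>Existence of penalized minimizers\<close>

text \<open>
  The penalized objective is only lower semicontinuous.  Induction on the set of jump terms: for
  a term \<open>e\<close>, either the minimizer pays \<open>c e\<close>, and the term may be treated as a constant on all of
  \<open>S\<close>, or it lies in the compact subset where \<open>d e\<close> vanishes.  The better of the two candidates
  provided by the induction hypothesis is a minimizer.
\<close>

lemma minimum_with_jump_penalty:
  fixes f :: "'a::topological_space \<Rightarrow> real" and d :: "'e \<Rightarrow> 'a \<Rightarrow> real"
  assumes "finite E" and "\<And>e. e \<in> E \<Longrightarrow> c e \<ge> 0"
    and "compact S" "S \<noteq> {}" "continuous_on S f"
    and "\<And>e. e \<in> E \<Longrightarrow> continuous_on S (d e)"
  shows "\<exists>x\<in>S. \<forall>y\<in>S. f x + (\<Sum>e\<in>E. c e * of_bool (d e x \<noteq> 0))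
                    \<le> f y + (\<Sum>e\<in>E. c e * of_bool (d e y \<noteq> 0))"
  using assms
proof (induction E arbitrary: S f rule: finite_induct)
  case empty
  then show ?case
    using continuous_attains_inf[of S f] by auto
next
  case (insert e E)
  define g where "g = (\<lambda>x. \<Sum>e\<in>E. c e * of_bool (d e x \<noteq> 0))"
  have F: "(\<Sum>e\<in>insert e E. c e * of_bool (d e x \<noteq> 0)) = c e * of_bool (d e x \<noteq> 0) + g x" for x
    using insert.hyps by (simp add: g_def)
  have "\<exists>x\<in>S. \<forall>y\<in>S. (f x + c e) + g x \<le> (f y + c e) + g y"
    unfolding g_def using insert.prems by (intro insert.IH continuous_intros) auto
  then obtain x1 where x1: "x1 \<in> S" "\<And>y. y \<in> S \<Longrightarrow> f x1 + g x1 \<le> f y + g y" by auto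
  define S0 where "S0 = {x \<in> S. d e x = 0}"
  show ?case
  proof (cases "S0 = {}")
    case True
    then show ?thesis
      using x1 by (intro bexI[of _ x1]) (auto simp: F S0_def)
  next
    case False
    \<comment> \<open>the topology need not be Hausdorff, so closedness is taken relative to S\<close>
    have "closedin (top_of_set S) S0"
      unfolding S0_def
      using continuous_closedin_preimage_constant[of S "d e" 0] insert.prems by auto
    then have "compact S0"
      using insert.prems(2) closedin_compact by blast
    have S0: "S0 \<subseteq> S" by (auto simp: S0_def)
    have "\<exists>x\<in>S0. \<forall>y\<in>S0. f x + g x \<le> f y + g y"
      unfolding g_def
      using insert.prems False \<open>compact S0\<close> S0
      by (intro insert.IH) (auto intro: continuous_on_subset)
    then obtain x0 where x0: "x0 \<in> S0" "\<And>y. y \<in> S0 \<Longrightarrow> f x0 + g x0 \<le> f y + g y" by auto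
    have ce: "c e \<ge> 0" using insert.prems by auto
    show ?thesis
    proof (cases "f x0 + g x0 \<le> f x1 + c e + g x1")
      case True
      have "f x0 + g x0 \<le> f y + c e * of_bool (d e y \<noteq> 0) + g y" if "y \<in> S" for y
        using True x1(2)[OF that] x0(2)[of y] that by (cases "d e y = 0") (auto simp: S0_def)
      then show ?thesis
        using x0(1) S0 by (intro bexI[of _ x0]) (auto simp: F S0_def add.assoc)
    next
      case lt: False
      have "f x1 + c e * of_bool (d e x1 \<noteq> 0) + g x1 \<le> f y + c e * of_bool (d e y \<noteq> 0) + g y"
        if "y \<in> S" for y
        using lt ce x1(2)[OF that] x0(2)[of y] that
        by (cases "d e y = 0"; cases "d e x1 = 0") (auto simp: S0_def)
      then show ?thesis
        using x1(1) by (intro bexI[of _ x1]) (auto simp: F add.assoc)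
    qed
  qed
qed

lemma continuous_on_L2_set_coordinate [continuous_intros]:
  "continuous_on S (\<lambda>u::vec. L2_set (u j) A)"
  unfolding L2_set_def by (intro continuous_intros)

lemma continuous_on_log_lik [continuous_intros]: "continuous_on S (\<lambda>u. log_lik J p vs u)"
proof -
  have pos: "1 + exp t > 0" for t :: real by (simp add: add_pos_pos)
  have lm: "continuous_on S (\<lambda>u. logistic_mean (linpred J p x u))" for x
    unfolding logistic_mean_def using pos by (intro continuous_intros) (metis less_irrefl)
  have range: "0 < logistic_mean t" "logistic_mean t < 1" for t
    using pos[of t] by (auto simp: logistic_mean_def field_simps)
  have "continuous_on S (\<lambda>u. ln (density_f J p v u))" for v
    unfolding density_f_def using range
    by (cases "fst v = 1") (auto intro!: continuous_intros lm simp: less_imp_neq[symmetric])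
  then show ?thesis
    unfolding log_lik_def by (induction vs) (auto intro: continuous_on_add)
qed

lemma M_pen_attains_minimum_on_compact:
  assumes "l0 \<ge> 0"
    and "\<And>j r s. j \<in> {1..J} \<Longrightarrow> (r, s) \<in> level_pairs (p j) \<Longrightarrow> w0 j r s > 0"
    and "compact S" "S \<noteq> {}"
  shows "\<exists>\<beta>\<in>S. \<forall>\<gamma>\<in>S. M_pen J p l1 l0 w1 w0 vs \<beta> \<le> M_pen J p l1 l0 w1 w0 vs \<gamma>"
proof -
  define E where "E = (SIGMA j:{1..J}. level_pairs (p j))"
  define c where "c = (\<lambda>(j, r, s). l0 * w0 j r s)"
  define d :: "nat \<times> nat \<times> nat \<Rightarrow> vec \<Rightarrow> real" where "d = (\<lambda>(j, r, s) u. u j r - u j s)"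
  define f where
    "f = (\<lambda>u. - log_lik J p vs u + l1 * (\<Sum>j\<in>{1..J}. w1 j * L2_set (u j) {1..p j}))"
  have M: "M_pen J p l1 l0 w1 w0 vs = (\<lambda>u. f u + (\<Sum>e\<in>E. c e * of_bool (d e u \<noteq> 0)))"
    by (simp add: fun_eq_iff M_pen_def f_def E_def c_def d_def sum.Sigma case_prod_unfold
        sum_distrib_left mult.assoc del: sum_mult_of_bool_eq)
  show ?thesis
    unfolding M
  proof (rule minimum_with_jump_penalty)
    show "finite E" by (auto simp: E_def)
    show "c e \<ge> 0" if "e \<in> E" for e
      using that assms(1) assms(2)
      by (force simp: E_def c_def intro!: mult_nonneg_nonneg intro: less_imp_le)
    show "continuous_on S f" unfolding f_def by (intro continuous_intros)
    show "continuous_on S (d e)" for e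
      unfolding d_def by (cases e) (auto intro!: continuous_intros)
  qed (use assms in auto)
qed

text \<open>
  If every parameter outside a ball around \<open>\<gamma>\<close> does worse than \<open>\<gamma>\<close>, the minimum over the compact ball
  is global, and every global minimizer is inside the ball.
\<close>

lemma M_pen_minimizer_near:
  assumes tuning: "l1 \<ge> 0" "l0 \<ge> 0"
    and w0: "\<And>j r s. j \<in> {1..J} \<Longrightarrow> (r, s) \<in> level_pairs (p j) \<Longrightarrow> w0 j r s > 0"
    and \<gamma>: "\<gamma> \<in> param_space J p" and "\<delta> > 0"
    and far: "\<And>\<beta>. \<beta> \<in> param_space J p \<Longrightarrow> l1_norm J p (\<lambda>j k. \<beta> j k - \<gamma> j k) \<ge> \<delta> \<Longrightarrow>
                M_pen J p l1 l0 w1 w0 vs \<gamma> < M_pen J p l1 l0 w1 w0 vs \<beta>"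
  shows "\<exists>\<beta>. is_minimizer J p l1 l0 w1 w0 vs \<beta>"
    and "is_minimizer J p l1 l0 w1 w0 vs \<beta> \<Longrightarrow> l1_norm J p (\<lambda>j k. \<beta> j k - \<gamma> j k) < \<delta>"
proof -
  define S where "S = {u \<in> param_space J p. l1_norm J p (\<lambda>j k. u j k - \<gamma> j k) \<le> \<delta>}"
  have S: "compact S" "\<gamma> \<in> S"
    using compact_l1_ball \<gamma> \<open>\<delta> > 0\<close> by (auto simp: S_def l1_norm_def case_prod_unfold)
  then obtain \<beta> where \<beta>: "\<beta> \<in> S"
    "\<And>u. u \<in> S \<Longrightarrow> M_pen J p l1 l0 w1 w0 vs \<beta> \<le> M_pen J p l1 l0 w1 w0 vs u"
    using M_pen_attains_minimum_on_compact[where S = S and J = J and p = p and ?w0.0 = w0, OF tuning(2) w0]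
    by blast
  have "M_pen J p l1 l0 w1 w0 vs \<beta> \<le> M_pen J p l1 l0 w1 w0 vs u" if u: "u \<in> param_space J p" for u
  proof (cases "u \<in> S")
    case False
    then have "M_pen J p l1 l0 w1 w0 vs \<gamma> < M_pen J p l1 l0 w1 w0 vs u"
      using u by (intro far) (auto simp: S_def)
    with \<beta>(2)[OF S(2)] show ?thesis by simp
  qed (use \<beta> in auto)
  moreover have "\<beta> \<in> param_space J p" using \<beta>(1) by (simp add: S_def)
  ultimately show "\<exists>\<beta>. is_minimizer J p l1 l0 w1 w0 vs \<beta>"
    unfolding is_minimizer_def is_arg_min_def by (meson not_le)
next
  assume "is_minimizer J p l1 l0 w1 w0 vs \<beta>"
  then show "l1_norm J p (\<lambda>j k. \<beta> j k - \<gamma> j k) < \<delta>"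
    using far[of \<beta>] \<gamma> unfolding is_minimizer_def is_arg_min_def by (meson not_le)
qed

section \<open>Events that hold with high probability\<close>

text \<open>
  Events are predicates of the sample.  As only finitely many samples of a given size exist, every
  such event is measurable, so failure probabilities are monotone and subadditive without side
  conditions.
\<close>

definition whp :: "'a measure \<Rightarrow> (nat \<Rightarrow> 'a \<Rightarrow> obs) \<Rightarrow> (nat \<Rightarrow> obs list \<Rightarrow> bool) \<Rightarrow> bool" where
  "whp M V Q \<longleftrightarrow> (\<lambda>n. measure M {\<omega> \<in> space M. \<not> Q n (sample V n \<omega>)}) \<longlonglongrightarrow> 0"

lemma iid_copies_measurable:
  assumes "prob_space M" "iid_copies J p M V D" "i \<ge> 1"
  shows "V i \<in> measurable M (count_space (obs_space J p))"
  using assms unfolding iid_copies_def prob_space.indep_vars_def[OF assms(1)] by auto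

lemma sample_in_samples:
  assumes "prob_space M" "iid_copies J p M V D" "\<omega> \<in> space M"
  shows "sample V n \<omega> \<in> samples J p n"
proof -
  have "V i \<omega> \<in> obs_space J p" if "i \<ge> 1" for i
    using measurable_space[OF iid_copies_measurable[OF assms(1,2) that] assms(3)] by simp
  then show ?thesis by (auto simp: samples_def sample_def in_lists_conv_set)
qed

lemma finite_samples: "finite (samples J p n)"
  using finite_lists_length_eq[OF finite_obs_space[of J p], of n]
  by (rule rev_finite_subset) (auto simp: samples_def in_lists_conv_set)

lemma sample_event_measurable:
  assumes "prob_space M" "iid_copies J p M V D"
  shows "{\<omega> \<in> space M. Q (sample V n \<omega>)} \<in> sets M"
proof -
  have coord: "{\<omega> \<in> space M. V i \<omega> = a} \<in> sets M" if "i \<ge> 1" for i a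
  proof -
    have "V i -` ({a} \<inter> obs_space J p) \<inter> space M \<in> sets M"
      by (rule measurable_sets[OF iid_copies_measurable[OF assms that]]) auto
    also have "V i -` ({a} \<inter> obs_space J p) \<inter> space M = {\<omega> \<in> space M. V i \<omega> = a}"
      using measurable_space[OF iid_copies_measurable[OF assms that]] by auto
    finally show ?thesis .
  qed
  have "{\<omega> \<in> space M. sample V n \<omega> = l} \<in> sets M" for l
  proof (cases "length l = n")
    case True
    have "{\<omega> \<in> space M. sample V n \<omega> = l} = {\<omega> \<in> space M. \<forall>i\<in>{..<n}. V (Suc i) \<omega> = l ! i}"
      using True by (auto simp: sample_def list_eq_iff_nth_eq simp del: upt_Suc)
    also have "\<dots> \<in> sets M"
      by (intro sets.sets_Collect_finite_All' sets.sets_Collect_finite_All coord) auto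
    finally show ?thesis .
  next
    case False
    moreover have "length (sample V n \<omega>) = n" for \<omega>
      by (simp add: sample_def del: upt_Suc)
    ultimately have "{\<omega> \<in> space M. sample V n \<omega> = l} = {}" by blast
    then show ?thesis by (simp only: sets.empty_sets)
  qed
  then have "(\<Union>l\<in>{l \<in> samples J p n. Q l}. {\<omega> \<in> space M. sample V n \<omega> = l}) \<in> sets M"
    using finite_samples by (intro sets.finite_UN) auto
  also have "(\<Union>l\<in>{l \<in> samples J p n. Q l}. {\<omega> \<in> space M. sample V n \<omega> = l})
      = {\<omega> \<in> space M. Q (sample V n \<omega>)}"
    using sample_in_samples[OF assms] by auto
  finally show ?thesis .
qed

lemma whp_mono:
  assumes "prob_space M" "iid_copies J p M V D" and Q: "whp M V Q"
    and "\<forall>\<^sub>F n in sequentially. \<forall>vs\<in>samples J p n. Q n vs \<longrightarrow> R n vs"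
  shows "whp M V R"
  unfolding whp_def
proof (rule tendsto_sandwich[OF _ _ tendsto_const])
  show "(\<lambda>n. measure M {\<omega> \<in> space M. \<not> Q n (sample V n \<omega>)}) \<longlonglongrightarrow> 0"
    using Q by (simp add: whp_def)
  show "\<forall>\<^sub>F n in sequentially. measure M {\<omega> \<in> space M. \<not> R n (sample V n \<omega>)}
          \<le> measure M {\<omega> \<in> space M. \<not> Q n (sample V n \<omega>)}"
    using assms(4)
  proof eventually_elim
    case (elim n)
    interpret prob_space M by fact
    show ?case
      using elim sample_in_samples[OF assms(1,2)]
      by (intro finite_measure_mono sample_event_measurable[OF assms(1,2)]) auto
  qed
qed auto

lemma whp_ball:
  assumes "prob_space M" "iid_copies J p M V D" "finite A" "\<And>a. a \<in> A \<Longrightarrow> whp M V (Q a)"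
  shows "whp M V (\<lambda>n vs. \<forall>a\<in>A. Q a n vs)"
  unfolding whp_def
proof (rule tendsto_sandwich[OF _ _ tendsto_const])
  show "(\<lambda>n. \<Sum>a\<in>A. measure M {\<omega> \<in> space M. \<not> Q a n (sample V n \<omega>)}) \<longlonglongrightarrow> 0"
    using assms(4) by (intro tendsto_null_sum) (auto simp: whp_def)
  show "\<forall>\<^sub>F n in sequentially. measure M {\<omega> \<in> space M. \<not> (\<forall>a\<in>A. Q a n (sample V n \<omega>))}
          \<le> (\<Sum>a\<in>A. measure M {\<omega> \<in> space M. \<not> Q a n (sample V n \<omega>)})"
  proof (intro always_eventually allI)
    fix n
    interpret prob_space M by fact
    have "{\<omega> \<in> space M. \<not> (\<forall>a\<in>A. Q a n (sample V n \<omega>))}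
            = (\<Union>a\<in>A. {\<omega> \<in> space M. \<not> Q a n (sample V n \<omega>)})" by auto
    also have "measure M \<dots> \<le> (\<Sum>a\<in>A. measure M {\<omega> \<in> space M. \<not> Q a n (sample V n \<omega>)})"
      using sample_event_measurable[OF assms(1,2)]
      by (intro finite_measure_subadditive_finite assms(3)) auto
    finally show "measure M {\<omega> \<in> space M. \<not> (\<forall>a\<in>A. Q a n (sample V n \<omega>))}
          \<le> (\<Sum>a\<in>A. measure M {\<omega> \<in> space M. \<not> Q a n (sample V n \<omega>)})" .
  qed
qed auto

lemma whp_conj:
  assumes "prob_space M" "iid_copies J p M V D" "whp M V Q" "whp M V R"
  shows "whp M V (\<lambda>n vs. Q n vs \<and> R n vs)"
  using whp_ball[OF assms(1,2), of "{Q, R}" "\<lambda>P. P"] assms(3,4) by auto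

lemma whp_conv_in_prob:
  assumes "conv_in_prob M (\<lambda>n \<omega>. X n (sample V n \<omega>)) c" "\<epsilon> > 0"
  shows "whp M V (\<lambda>n vs. \<bar>X n vs - c\<bar> \<le> \<epsilon>)"
  using assms unfolding conv_in_prob_def whp_def by (simp add: not_le)

text \<open>
  Functions of one observation are bounded because the observation space is finite, so
  Hoeffding's inequality applies and the failure probability even decays exponentially.
\<close>

lemma weak_law_of_large_numbers:
  fixes h :: "obs \<Rightarrow> real"
  assumes prob: "prob_space M" and iid: "iid_copies J p M V D" and "\<epsilon> > 0"
  shows "whp M V (\<lambda>n vs. \<bar>(\<Sum>v\<leftarrow>vs. h v) - n * (\<integral>v. h v \<partial>D)\<bar> \<le> n * \<epsilon>)"
proof -
  interpret prob_space M by fact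
  define S where "S = obs_space J p"
  \<comment> \<open>the summand 1 keeps the interval from \<open>- C\<close> to \<open>C\<close> nondegenerate when \<open>h\<close> vanishes\<close>
  define C where "C = (\<Sum>v\<in>S. \<bar>h v\<bar>) + 1"
  have bound: "\<bar>h v\<bar> < C" if "v \<in> S" for v
    using member_le_sum[of v S "\<lambda>v. \<bar>h v\<bar>"] that by (simp add: S_def C_def)
  have "C > 0" by (auto simp: C_def intro!: add_nonneg_pos sum_nonneg)
  have V: "V i \<in> measurable M (count_space S)" if "i \<ge> 1" for i
    using iid_copies_measurable[OF prob iid that] by (simp add: S_def)
  have D: "distr M (count_space S) (V i) = D" if "i \<ge> 1" for i
    using iid that by (simp add: iid_copies_def S_def)
  have indep: "indep_vars (\<lambda>_. borel) (\<lambda>i \<omega>. h (V i \<omega>)) {1..n}" for n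
  proof (rule indep_vars_compose2[where M' = "\<lambda>_. count_space S" and X = V and Y = "\<lambda>_. h"])
    show "indep_vars (\<lambda>_. count_space S) V {1..n}"
      by (rule indep_vars_subset[where I = "{1..}"])
        (use iid in \<open>auto simp: iid_copies_def S_def\<close>)
  qed simp
  have law: "distr M borel (\<lambda>\<omega>. h (V i \<omega>)) = distr D borel h" if "i \<ge> 1" for i
    using distr_distr[of h "count_space S" borel "V i" M, OF _ V[OF that]]
    unfolding D[OF that] by (simp add: comp_def)
  have mean: "expectation (\<lambda>\<omega>. h (V 1 \<omega>)) = (\<integral>v. h v \<partial>D)"
    using integral_distr[of "V 1" M "count_space S" h] V[of 1] D[of 1] by simp
  have rv: "(\<lambda>\<omega>. h (V i \<omega>)) \<in> borel_measurable M" if "i \<ge> 1" for i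
    using measurable_compose[OF V[OF that], of h borel] by simp
  have tail: "prob {\<omega> \<in> space M. \<not> \<bar>(\<Sum>v\<leftarrow>sample V n \<omega>. h v) - n * (\<integral>v. h v \<partial>D)\<bar> \<le> n * \<epsilon>}
      \<le> 2 * exp (- 2 * n * \<epsilon>\<^sup>2 / (C - - C)\<^sup>2)" if "n > 0" for n
  proof -
    interpret H: Hoeffding_ineq_iid M "{1..n}" "\<lambda>i \<omega>. h (V i \<omega>)" "\<lambda>\<omega>. h (V 1 \<omega>)"
      "- C" C "\<integral>v. h v \<partial>D"
    proof (unfold_locales, goal_cases)
      case 5
      have "V 1 \<omega> \<in> S" if "\<omega> \<in> space M" for \<omega>
        using measurable_space[OF V[of 1] that] by simp
      then have "h (V 1 \<omega>) \<in> {- C..C}" if "\<omega> \<in> space M" for \<omega>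
        using bound[of "V 1 \<omega>"] that unfolding atLeastAtMost_iff by fastforce
      then show ?case by (rule AE_I2)
    next
      show "(\<integral>v. h v \<partial>D) \<equiv> expectation (\<lambda>\<omega>. h (V 1 \<omega>))"
        by (rule eq_reflection) (rule mean[symmetric])
    qed (use indep law rv[of 1] in auto)
    have "{\<omega> \<in> space M. \<not> \<bar>(\<Sum>v\<leftarrow>sample V n \<omega>. h v) - n * (\<integral>v. h v \<partial>D)\<bar> \<le> n * \<epsilon>}
      \<subseteq> {\<omega> \<in> space M. \<bar>(\<Sum>i\<in>{1..n}. h (V i \<omega>)) / real (card {1..n}) - (\<integral>v. h v \<partial>D)\<bar> \<ge> \<epsilon>}"
    proof safe
      fix \<omega> assume "\<not> \<bar>(\<Sum>v\<leftarrow>sample V n \<omega>. h v) - n * (\<integral>v. h v \<partial>D)\<bar> \<le> n * \<epsilon>"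
      moreover have "(\<Sum>v\<leftarrow>sample V n \<omega>. h v) = (\<Sum>i\<in>{1..n}. h (V i \<omega>))"
        by (simp add: sample_def comp_def sum_list_distinct_conv_sum_set
            atLeastLessThanSuc_atLeastAtMost del: upt_Suc)
      moreover have "(\<Sum>i\<in>{1..n}. h (V i \<omega>)) - n * (\<integral>v. h v \<partial>D)
          = n * ((\<Sum>i\<in>{1..n}. h (V i \<omega>)) / n - (\<integral>v. h v \<partial>D))"
        using \<open>n > 0\<close> by (simp add: algebra_simps)
      ultimately have "n * \<epsilon> < n * \<bar>(\<Sum>i\<in>{1..n}. h (V i \<omega>)) / n - (\<integral>v. h v \<partial>D)\<bar>"
        by (simp add: abs_mult)
      then show "\<bar>(\<Sum>i\<in>{1..n}. h (V i \<omega>)) / real (card {1..n}) - (\<integral>v. h v \<partial>D)\<bar> \<ge> \<epsilon>"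
        using \<open>n > 0\<close> by simp
    qed
    then have "prob {\<omega> \<in> space M. \<not> \<bar>(\<Sum>v\<leftarrow>sample V n \<omega>. h v) - n * (\<integral>v. h v \<partial>D)\<bar> \<le> n * \<epsilon>}
      \<le> prob {\<omega> \<in> space M. \<bar>(\<Sum>i\<in>{1..n}. h (V i \<omega>)) / real (card {1..n}) - (\<integral>v. h v \<partial>D)\<bar> \<ge> \<epsilon>}"
      using rv by (intro finite_measure_mono) (auto intro!: borel_measurable_sum)
    also have "\<dots> \<le> 2 * exp (- 2 * real (card {1..n}) * \<epsilon>\<^sup>2 / (C - - C)\<^sup>2)"
      using \<open>\<epsilon> > 0\<close> \<open>C > 0\<close> \<open>n > 0\<close> by (intro H.Hoeffding_ineq_abs_ge') auto
    finally show ?thesis by simp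
  qed
  show ?thesis
    unfolding whp_def
  proof (rule tendsto_sandwich[OF _ _ tendsto_const])
    define r where "r = 2 * \<epsilon>\<^sup>2 / (C - - C)\<^sup>2"
    have "r > 0" using \<open>\<epsilon> > 0\<close> \<open>C > 0\<close> by (simp add: r_def)
    then have "exp (- r) < 1" by simp
    then have "(\<lambda>n. 2 * exp (- r) ^ n) \<longlonglongrightarrow> 0"
      by (intro tendsto_mult_right_zero LIMSEQ_realpow_zero) auto
    moreover have "2 * exp (- r) ^ n = 2 * exp (- 2 * n * \<epsilon>\<^sup>2 / (C - - C)\<^sup>2)" for n :: nat
      by (simp add: r_def exp_of_nat_mult[symmetric] field_simps)
    ultimately show "(\<lambda>n. 2 * exp (- 2 * real n * \<epsilon>\<^sup>2 / (C - - C)\<^sup>2)) \<longlonglongrightarrow> 0" by simp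
    show "\<forall>\<^sub>F n in sequentially.
        prob {\<omega> \<in> space M. \<not> \<bar>(\<Sum>v\<leftarrow>sample V n \<omega>. h v) - n * (\<integral>v. h v \<partial>D)\<bar> \<le> n * \<epsilon>}
        \<le> 2 * exp (- 2 * real n * \<epsilon>\<^sup>2 / (C - - C)\<^sup>2)"
      using eventually_gt_at_top[of 0] by eventually_elim (rule tail)
  qed auto
qed

section \<open>Consequences of the model for the population law\<close>

definition design_prob :: "obs measure \<Rightarrow> vec \<Rightarrow> real" where
  "design_prob D x = measure D {v \<in> space D. snd v = x}"

text \<open>
  The event that the covariate equals \<open>x\<close> belongs to the sigma-algebra of the covariate, so the
  response and its conditional expectation have the same integral over it.
\<close>

lemma logistic_model_score_mean:
  assumes D: "prob_space D" "space D = obs_space J p" "sets D = Pow (obs_space J p)"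
    and model: "logistic_model J p D \<beta>" and x: "x \<in> design_space J p"
  shows "(\<integral>v. of_bool (snd v = x) * (fst v - logistic_mean (linpred J p x \<beta>)) \<partial>D) = 0"
proof -
  interpret prob_space D by fact
  define F where "F = vimage_algebra (space D) snd (count_space (design_space J p))"
  have meas: "f \<in> borel_measurable D" for f :: "obs \<Rightarrow> real"
    using D(2,3) by (auto simp: measurable_def)
  have integrable: "integrable D f" for f :: "obs \<Rightarrow> real"
    by (rule integrable_const_bound[where B = "\<Sum>v\<in>space D. \<bar>f v\<bar>"])
      (auto intro!: AE_I2 meas member_le_sum simp: D(2))
  have "subalgebra D F"
    unfolding subalgebra_def F_def
    by (subst sets_vimage_algebra2) (auto simp: D obs_space_def)
  then interpret finite_measure_subalgebra D F
    by unfold_locales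
  define A where "A = {v \<in> space D. snd v = x}"
  have "A = snd -` {x} \<inter> space D" by (auto simp: A_def)
  then have "A \<in> sets F"
    unfolding F_def using x by (auto intro!: in_vimage_algebra)
  have "(\<integral>v\<in>A. fst v \<partial>D) = (\<integral>v\<in>A. real_cond_exp D F fst v \<partial>D)"
    by (intro real_cond_exp_intA integrable \<open>A \<in> sets F\<close>)
  also have "\<dots> = (\<integral>v\<in>A. logistic_mean (linpred J p x \<beta>) \<partial>D)"
    unfolding set_lebesgue_integral_def
    by (rule integral_cong_AE[OF meas meas])
      (use model in \<open>auto simp: logistic_model_def F_def A_def indicator_def elim!: eventually_mono\<close>)
  finally have "(\<integral>v\<in>A. fst v - logistic_mean (linpred J p x \<beta>) \<partial>D) = 0"
    using integrable by (subst set_integral_diff) (auto simp: set_integrable_def)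
  moreover have "(\<integral>v\<in>A. fst v - logistic_mean (linpred J p x \<beta>) \<partial>D)
     = (\<integral>v. of_bool (snd v = x) * (fst v - logistic_mean (linpred J p x \<beta>)) \<partial>D)"
    unfolding set_lebesgue_integral_def
    by (rule Bochner_Integration.integral_cong) (auto simp: A_def)
  ultimately show ?thesis by simp
qed

text \<open>
  The quadratic form of the Fisher information at \<open>u\<close> is the expectation of
  \<open>phi'' \<cdot> (linpred x u)\<^sup>2\<close>.  If the sum below were 0, the predictor of \<open>u\<close> would vanish almost surely
  and so would the form.
\<close>

lemma fisher_positive_definite_identifies:
  assumes D: "prob_space D" "space D = obs_space J p" "sets D = Pow (obs_space J p)"
    and reg2: "reg2 J p D \<beta>" and u: "u \<in> param_space J p" "u \<noteq> (\<lambda>_ _. 0)"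
  shows "(\<Sum>x\<in>design_space J p. design_prob D x * \<bar>linpred J p x u\<bar>) > 0"
proof (rule ccontr)
  interpret prob_space D by fact
  assume "\<not> ?thesis"
  moreover have nonneg: "design_prob D x * \<bar>linpred J p x u\<bar> \<ge> 0" for x
    by (simp add: design_prob_def)
  ultimately have "(\<Sum>x\<in>design_space J p. design_prob D x * \<bar>linpred J p x u\<bar>) = 0"
    by (meson sum_nonneg less_eq_real_def not_less)
  then have zero: "\<forall>x\<in>design_space J p. design_prob D x = 0 \<or> linpred J p x u = 0"
    using nonneg by (subst (asm) sum_nonneg_eq_0_iff) auto
  have "AE v in D. \<forall>x\<in>design_space J p. snd v = x \<longrightarrow> linpred J p x u = 0"
  proof (rule AE_finite_allI)
    fix x assume x: "x \<in> design_space J p"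
    show "AE v in D. snd v = x \<longrightarrow> linpred J p x u = 0"
    proof (cases "linpred J p x u = 0")
      case False
      have "{v \<in> space D. snd v = x} \<in> sets D" using D(2,3) by auto
      then have "AE v in D. v \<notin> {v \<in> space D. snd v = x}"
        using zero x False by (subst prob_eq_0[symmetric]) (auto simp: design_prob_def)
      then show ?thesis by (rule AE_mp) (auto intro!: AE_I2)
    qed auto
  qed simp
  moreover have "AE v in D. snd v \<in> design_space J p"
    by (rule AE_I2) (auto simp: D(2) obs_space_def)
  ultimately have ae: "AE v in D. linpred J p (snd v) u = 0"
    by eventually_elim auto
  have int: "integrable D (fisher_integrand J p \<beta> a b)" if "a \<in> idx J p" "b \<in> idx J p" for a b
    using reg2 that by (simp add: reg2_def)
  have "(\<Sum>a\<in>idx J p. \<Sum>b\<in>idx J p. case_prod u a * fisher J p D \<beta> a b * case_prod u b)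
     = (\<integral>v. (\<Sum>a\<in>idx J p. \<Sum>b\<in>idx J p.
          case_prod u a * fisher_integrand J p \<beta> a b v * case_prod u b) \<partial>D)"
    unfolding fisher_def using int by (simp add: Bochner_Integration.integral_sum)
  also have "\<dots> = (\<integral>v. (deriv ^^ 2) phi (linpred J p (snd v) \<beta>) * (linpred J p (snd v) u)\<^sup>2 \<partial>D)"
    by (intro Bochner_Integration.integral_cong)
      (simp_all add: fisher_integrand_def linpred_altdef power2_eq_square sum_product
        sum_distrib_left mult_ac del: funpow.simps)
  also have "\<dots> = 0"
    by (rule integral_eq_zero_AE) (use ae in eventually_elim, simp)
  finally show False
    using reg2 u by (auto simp: reg2_def)
qed

section \<open>Screening property of the estimator\<close>

lemma nonzero_coefficients_bounded_below:
  fixes \<beta> :: vec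
  shows "\<exists>\<delta>>0. \<forall>(j, k)\<in>idx J p. \<beta> j k \<noteq> 0 \<longrightarrow> \<delta> \<le> \<bar>\<beta> j k\<bar>"
proof -
  \<comment> \<open>the element 1 only makes \<open>Min\<close> meaningful when all coefficients are 0\<close>
  define A where "A = insert 1 ((\<lambda>a. \<bar>case_prod \<beta> a\<bar>) ` {a \<in> idx J p. case_prod \<beta> a \<noteq> 0})"
  have "finite A" "\<forall>t\<in>A. t > 0" by (auto simp: A_def)
  then have "Min A > 0" "\<forall>t\<in>A. Min A \<le> t" by (auto simp: A_def)
  moreover have "\<bar>\<beta> j k\<bar> \<in> A" if "(j, k) \<in> idx J p" "\<beta> j k \<noteq> 0" for j k
    using that by (auto simp: A_def intro!: image_eqI[of _ _ "(j, k)"])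
  ultimately show ?thesis by (intro exI[of _ "Min A"]) auto
qed

text \<open>
  A coefficient of \<open>\<gamma>\<close> that is at least \<open>\<delta>\<close> in absolute value cannot be moved to 0 by a perturbation
  of norm less than \<open>\<delta>\<close>.
\<close>

lemma active_set_mono_near:
  assumes "\<forall>(j, k)\<in>idx J p. \<gamma> j k \<noteq> 0 \<longrightarrow> \<delta> \<le> \<bar>\<gamma> j k\<bar>"
    and near: "l1_norm J p (\<lambda>j k. \<beta> j k - \<gamma> j k) < \<delta>"
  shows "active_set J p \<gamma> \<subseteq> active_set J p \<beta>"
proof
  fix j assume "j \<in> active_set J p \<gamma>"
  then obtain k where jk: "j \<in> {1..J}" "k \<in> {1..p j}" "\<gamma> j k \<noteq> 0"
    by (auto simp: active_set_def)
  then have "(j, k) \<in> idx J p" by (auto simp: idx_def dummy_idx_def)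
  with assms(1) jk(3) coordinate_le_l1_norm[of j k J p "\<lambda>j k. \<beta> j k - \<gamma> j k"] near
  have "\<bar>\<beta> j k - \<gamma> j k\<bar> < \<bar>\<gamma> j k\<bar>" by fastforce
  then have "\<beta> j k \<noteq> 0" by auto
  with jk show "j \<in> active_set J p \<beta>" by (auto simp: active_set_def)
qed

lemma eventually_sqrt_less_linear:
  fixes a b c :: real
  assumes "a \<ge> 0" "b \<ge> 0" "c > 0"
  shows "\<forall>\<^sub>F n in sequentially. a * sqrt (real n) + b < c * real n"
proof -
  have "filterlim (\<lambda>n. sqrt (real n)) at_top sequentially"
    by (intro filterlim_compose[OF sqrt_at_top] filterlim_real_sequentially)
  then have "\<forall>\<^sub>F n in sequentially. (a + b) / c < sqrt (real n)"
    by (simp add: filterlim_at_top_dense)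
  then show ?thesis
    using eventually_ge_at_top[of 1]
  proof eventually_elim
    case (elim n)
    then have s: "1 \<le> sqrt (real n)" by simp
    have "a * sqrt (real n) + b \<le> (a + b) * sqrt (real n)"
      using mult_left_mono[OF s assms(2)] by (simp add: algebra_simps)
    also have "\<dots> < (c * sqrt (real n)) * sqrt (real n)"
      using elim(1) s assms(3) by (intro mult_strict_right_mono) (auto simp: field_simps)
    also have "\<dots> = c * real n" by simp
    finally show ?case .
  qed
qed

theorem theorem3p8:
  fixes J :: nat and p :: "nat \<Rightarrow> nat"
    and M :: "'a measure" and V :: "nat \<Rightarrow> 'a \<Rightarrow> obs" and D :: "obs measure"
    and \<beta>s :: vec
    and l1 l0 :: "nat \<Rightarrow> real"
    and w1 :: "nat \<Rightarrow> obs list \<Rightarrow> nat \<Rightarrow> real"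
    and w0 :: "nat \<Rightarrow> obs list \<Rightarrow> nat \<Rightarrow> nat \<Rightarrow> nat \<Rightarrow> real"
    and K :: real
  assumes levels: "\<And>j. j \<in> {1..J} \<Longrightarrow> p j \<ge> 1"
    and prob: "prob_space M"
    and iid: "iid_copies J p M V D"
    and true_param: "\<beta>s \<in> param_space J p"
    and model: "logistic_model J p D \<beta>s"
    and tuning: "\<And>n. l1 n \<ge> 0" "\<And>n. l0 n \<ge> 0"
    and w1_pos: "\<And>n vs j. vs \<in> samples J p n \<Longrightarrow> j \<in> {1..J} \<Longrightarrow> w1 n vs j > 0"
    and w0_pos: "\<And>n vs j r s. vs \<in> samples J p n \<Longrightarrow> j \<in> {1..J} \<Longrightarrow> (r, s) \<in> level_pairs (p j)
                   \<Longrightarrow> w0 n vs j r s > 0"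
    and reg1: "reg1 J p"
    and reg2: "reg2 J p D \<beta>s"
    and reg3: "reg3 J p D \<beta>s"
    and a1_lim: "conv_in_prob M (\<lambda>n \<omega>. a1 J (l1 n) (w1 n (sample V n \<omega>)) / sqrt (real n)) 0"
    and a0_lim: "conv_in_prob M (\<lambda>n \<omega>. a0 J p (l0 n) (w0 n (sample V n \<omega>))) K"
    and sparsity: "sparse_structure J p \<beta>s"
  shows "\<exists>\<beta>h :: nat \<Rightarrow> obs list \<Rightarrow> vec.
     (\<forall>n. (\<Sum>j\<in>{1..J}. p j) < n \<longrightarrow>
        L0_FGL_estimator J p n (l1 n) (l0 n) (w1 n) (w0 n) (\<beta>h n)) \<and>
     (\<lambda>n. measure M {\<omega> \<in> space M.
        is_minimizer J p (l1 n) (l0 n) (w1 n (sample V n \<omega>)) (w0 n (sample V n \<omega>))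
          (sample V n \<omega>) (\<beta>h n (sample V n \<omega>))}) \<longlonglongrightarrow> 1 \<and>
     (\<forall>\<epsilon>>0. \<exists>N>0. \<forall>n\<ge>N. (\<Sum>j\<in>{1..J}. p j) < n \<longrightarrow>
        measure M {\<omega> \<in> space M.
          \<not> active_set J p \<beta>s \<subseteq> active_set J p (\<beta>h n (sample V n \<omega>))} < \<epsilon>)"
proof -
  interpret prob_space M by (rule prob)
  let ?X = "design_space J p"
  let ?MP = "\<lambda>n vs. M_pen J p (l1 n) (l0 n) (w1 n vs) (w0 n vs) vs"
  let ?min = "\<lambda>n vs. is_minimizer J p (l1 n) (l0 n) (w1 n vs) (w0 n vs) vs"
  have V1: "V 1 \<in> measurable M (count_space (obs_space J p))"
    by (rule iid_copies_measurable[OF prob iid]) simp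
  have "distr M (count_space (obs_space J p)) (V 1) = D"
    using iid by (simp add: iid_copies_def)
  then have D: "prob_space D" "space D = obs_space J p" "sets D = Pow (obs_space J p)"
    using prob_space_distr[OF V1] by auto
  obtain \<kappa> where \<kappa>: "\<kappa> > 0" "\<And>u. u \<in> param_space J p \<Longrightarrow>
      \<kappa> * l1_norm J p u \<le> (\<Sum>x\<in>?X. design_prob D x * \<bar>linpred J p x u\<bar>)"
    using weighted_linpred_dominates_l1_norm[of ?X "design_prob D" J p]
      fisher_positive_definite_identifies[OF D reg2]
    by (auto simp: design_prob_def)
  obtain \<delta> where \<delta>: "\<delta> > 0" "\<forall>(j, k)\<in>idx J p. \<beta>s j k \<noteq> 0 \<longrightarrow> \<delta> \<le> \<bar>\<beta>s j k\<bar>"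
    using nonzero_coefficients_bounded_below by blast
  \<comment> \<open>\<open>\<tau>\<close> and \<open>\<epsilon>\<close> are chosen so that each of the two losses in \<open>log_lik_gap\<close> uses up a quarter of the
    gain \<open>b \<kappa>\<close> per unit of norm at distances \<open>\<delta>\<close> or more; the remaining half, collected over a
    distance \<open>\<delta>\<close>, is \<open>c\<close>\<close>
  define \<tau> where "\<tau> = \<kappa> * \<delta> / 4"
  have "\<tau> > 0" using \<kappa>(1) \<delta>(1) by (simp add: \<tau>_def)
  then obtain b where b: "b > 0" "\<And>x \<eta>. x \<in> ?X \<Longrightarrow>
      phi_bregman (linpred J p x \<beta>s) \<eta> \<ge> b * (\<bar>\<eta> - linpred J p x \<beta>s\<bar> - \<tau>)"
    using phi_bregman_lower_bound_uniform[of \<tau> "(\<lambda>x. linpred J p x \<beta>s) ` ?X"] by auto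
  define \<epsilon> where "\<epsilon> = b * \<kappa> / (4 * ((1 + b) * (real (card ?X) + 1)))"
  have "\<epsilon> > 0" using b(1) \<kappa>(1) by (simp add: \<epsilon>_def)
  have \<epsilon>: "(1 + b) * card ?X * \<epsilon> \<le> b * \<kappa> / 4"
  proof -
    have "(1 + b) * card ?X * \<epsilon> \<le> (1 + b) * (real (card ?X) + 1) * \<epsilon>"
      using b(1) \<open>\<epsilon> > 0\<close> by (intro mult_right_mono mult_left_mono) auto
    also have "\<dots> = b * \<kappa> / 4" using b(1) by (simp add: \<epsilon>_def)
    finally show ?thesis .
  qed
  define c where "c = b * \<kappa> * \<delta> / 2"
  have "c > 0" using b(1) \<kappa>(1) \<delta>(1) by (simp add: c_def)
  define L where "L = (\<Sum>j\<in>{1..J}. L2_set (\<beta>s j) {1..p j})"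
  define C where "C = real (\<Sum>j\<in>{1..J}. card (level_pairs (p j)))"
  have "L \<ge> 0" "C \<ge> 0" by (auto simp: L_def C_def intro!: sum_nonneg)

  define good where "good = (\<lambda>n vs.
    ((\<forall>x\<in>?X. \<bar>design_count vs x - real n * design_prob D x\<bar> \<le> real n * \<epsilon>)
      \<and> (\<forall>x\<in>?X. \<bar>design_score J p \<beta>s vs x\<bar> \<le> real n * \<epsilon>))
    \<and> \<bar>a1 J (l1 n) (w1 n vs) / sqrt (real n) - 0\<bar> \<le> 1 \<and> \<bar>a0 J p (l0 n) (w0 n vs) - K\<bar> \<le> 1)"
  have "whp M V good"
    unfolding good_def
  proof (intro whp_conj[OF prob iid] whp_ball[OF prob iid])
    fix x assume x: "x \<in> ?X"
    have "(\<integral>v. of_bool (snd v = x) \<partial>D) = design_prob D x"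
    proof -
      have "(\<integral>v. of_bool (snd v = x) \<partial>D) = (\<integral>v. indicator {v \<in> space D. snd v = x} v \<partial>D :: real)"
        by (intro Bochner_Integration.integral_cong) auto
      also have "\<dots> = design_prob D x"
        by (auto simp: design_prob_def intro!: arg_cong[of _ _ "measure D"])
      finally show ?thesis .
    qed
    with weak_law_of_large_numbers[OF prob iid \<open>\<epsilon> > 0\<close>, of "\<lambda>v. of_bool (snd v = x)"]
    show "whp M V (\<lambda>n vs. \<bar>design_count vs x - real n * design_prob D x\<bar> \<le> real n * \<epsilon>)"
      by (simp add: design_count_def)
    from weak_law_of_large_numbers[OF prob iid \<open>\<epsilon> > 0\<close>, of
        "\<lambda>v. of_bool (snd v = x) * (fst v - logistic_mean (linpred J p x \<beta>s))"]
    show "whp M V (\<lambda>n vs. \<bar>design_score J p \<beta>s vs x\<bar> \<le> real n * \<epsilon>)"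
      unfolding logistic_model_score_mean[OF D model x] design_score_def by simp
  qed (use whp_conv_in_prob[OF a1_lim] whp_conv_in_prob[OF a0_lim] in auto)

  \<comment> \<open>the likelihood loss \<open>c n\<close> outside the ball exceeds the whole penalty of the true parameter\<close>
  have far: "?MP n vs \<beta>s < ?MP n vs \<beta>"
    if vs: "vs \<in> samples J p n" and "good n vs" and n: "n > 0"
      and large: "L * sqrt (real n) + (\<bar>K\<bar> + 1) * C < c * real n"
      and \<beta>: "\<beta> \<in> param_space J p" and N: "l1_norm J p (\<lambda>j k. \<beta> j k - \<beta>s j k) \<ge> \<delta>" for n vs \<beta>
  proof -
    define N where "N = l1_norm J p (\<lambda>j k. \<beta> j k - \<beta>s j k)"
    have "c = (3 / 4 * (b * \<kappa>)) * \<delta> - b * \<tau>" by (simp add: c_def \<tau>_def)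
    also have "\<dots> \<le> (3 / 4 * (b * \<kappa>)) * N - b * \<tau>"
      using N b(1) \<kappa>(1) by (intro diff_right_mono mult_left_mono) (auto simp: N_def)
    also have "\<dots> \<le> (b * \<kappa> - (1 + b) * card ?X * \<epsilon>) * N - b * \<tau>"
    proof (intro diff_right_mono mult_right_mono)
      show "3 / 4 * (b * \<kappa>) \<le> b * \<kappa> - (1 + b) * card ?X * \<epsilon>"
        using \<epsilon> by linarith
      show "N \<ge> 0" by (simp add: N_def l1_norm_nonneg)
    qed
    finally have "real n * c \<le> real n * ((b * \<kappa> - (1 + b) * card ?X * \<epsilon>) * N - b * \<tau>)"
      by (intro mult_left_mono) auto
    also have "\<dots> \<le> log_lik J p vs \<beta>s - log_lik J p vs \<beta>"
      unfolding N_def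
    proof (rule log_lik_gap[OF reg1 vs \<beta> true_param])
      show "\<kappa> * l1_norm J p (\<lambda>j k. \<beta> j k - \<beta>s j k)
          \<le> (\<Sum>x\<in>?X. design_prob D x * \<bar>linpred J p x \<beta> - linpred J p x \<beta>s\<bar>)"
        unfolding linpred_diff by (intro \<kappa>(2) diff_in_param_space \<beta> true_param)
    qed (use b \<open>good n vs\<close> in \<open>auto simp: good_def\<close>)
    finally have gap: "real n * c \<le> log_lik J p vs \<beta>s - log_lik J p vs \<beta>" .
    have "a1 J (l1 n) (w1 n vs) \<le> sqrt (real n)" "a0 J p (l0 n) (w0 n vs) \<le> \<bar>K\<bar> + 1"
      using \<open>good n vs\<close> n by (auto simp: good_def field_simps abs_if split: if_splits)
    then have "a1 J (l1 n) (w1 n vs) * L + a0 J p (l0 n) (w0 n vs) * C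
        \<le> sqrt (real n) * L + (\<bar>K\<bar> + 1) * C"
      using \<open>L \<ge> 0\<close> \<open>C \<ge> 0\<close> by (intro add_mono mult_right_mono)
    moreover have "penalty J p (l1 n) (l0 n) (w1 n vs) (w0 n vs) \<beta>s
        \<le> a1 J (l1 n) (w1 n vs) * L + a0 J p (l0 n) (w0 n vs) * C"
      unfolding L_def C_def using tuning w0_pos[OF vs] by (intro penalty_le) auto
    moreover have "penalty J p (l1 n) (l0 n) (w1 n vs) (w0 n vs) \<beta> \<ge> 0"
      using tuning w1_pos[OF vs] w0_pos[OF vs] by (intro penalty_nonneg) auto
    ultimately show ?thesis
      using gap large unfolding M_pen_altdef by (simp add: mult.commute)
  qed

  have close: "whp M V (\<lambda>n vs. (\<exists>\<beta>. ?min n vs \<beta>) \<and>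
      (\<forall>\<beta>. ?min n vs \<beta> \<longrightarrow> active_set J p \<beta>s \<subseteq> active_set J p \<beta>))"
  proof (rule whp_mono[OF prob iid \<open>whp M V good\<close>])
    have "\<forall>\<^sub>F n in sequentially. L * sqrt (real n) + (\<bar>K\<bar> + 1) * C < c * real n"
      using \<open>L \<ge> 0\<close> \<open>C \<ge> 0\<close> \<open>c > 0\<close> by (intro eventually_sqrt_less_linear) auto
    then show "\<forall>\<^sub>F n in sequentially. \<forall>vs\<in>samples J p n. good n vs \<longrightarrow> (\<exists>\<beta>. ?min n vs \<beta>) \<and>
        (\<forall>\<beta>. ?min n vs \<beta> \<longrightarrow> active_set J p \<beta>s \<subseteq> active_set J p \<beta>)"
      using eventually_gt_at_top[of 0]
    proof eventually_elim
      case (elim n)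
      show ?case
      proof (intro ballI impI)
        fix vs assume vs: "vs \<in> samples J p n" "good n vs"
        note near = M_pen_minimizer_near[where ?l1.0 = "l1 n" and ?l0.0 = "l0 n" and ?w1.0 = "w1 n vs"
            and ?w0.0 = "w0 n vs" and vs = vs, OF tuning w0_pos[OF vs(1)] true_param \<delta>(1)
            far[OF vs elim(2,1)]]
        show "(\<exists>\<beta>. ?min n vs \<beta>) \<and>
            (\<forall>\<beta>. ?min n vs \<beta> \<longrightarrow> active_set J p \<beta>s \<subseteq> active_set J p \<beta>)"
          using near active_set_mono_near[OF \<delta>(2)] by blast
      qed
    qed
  qed

  define \<beta>h where "\<beta>h = (\<lambda>n vs. if \<exists>\<beta>. ?min n vs \<beta> then SOME \<beta>. ?min n vs \<beta> else (\<lambda>_ _. 0))"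
  have \<beta>h: "?min n vs (\<beta>h n vs)" if "\<exists>\<beta>. ?min n vs \<beta>" for n vs
    using someI_ex[OF that] that by (simp add: \<beta>h_def)
  have est: "L0_FGL_estimator J p n (l1 n) (l0 n) (w1 n) (w0 n) (\<beta>h n)" for n
    unfolding L0_FGL_estimator_def
  proof (intro ballI conjI impI)
    fix vs
    show "?min n vs (\<beta>h n vs)" if "\<exists>\<beta>. ?min n vs \<beta>"
      by (rule \<beta>h[OF that])
    show "\<beta>h n vs \<in> param_space J p"
    proof (cases "\<exists>\<beta>. ?min n vs \<beta>")
      case True
      from \<beta>h[OF this] show ?thesis by (simp add: is_minimizer_def is_arg_min_def)
    next
      case False
      then have "\<beta>h n vs = (\<lambda>_ _. 0)" by (auto simp: \<beta>h_def)
      then show ?thesis by (simp add: param_space_def)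
    qed
  qed
  have "whp M V (\<lambda>n vs. ?min n vs (\<beta>h n vs))"
    by (rule whp_mono[OF prob iid close], intro always_eventually allI ballI impI \<beta>h) blast
  then have "(\<lambda>n. 1 - prob {\<omega> \<in> space M. \<not> ?min n (sample V n \<omega>) (\<beta>h n (sample V n \<omega>))}) \<longlonglongrightarrow> 1 - 0"
    unfolding whp_def by (intro tendsto_intros)
  moreover have "1 - prob {\<omega> \<in> space M. \<not> ?min n (sample V n \<omega>) (\<beta>h n (sample V n \<omega>))}
      = prob {\<omega> \<in> space M. ?min n (sample V n \<omega>) (\<beta>h n (sample V n \<omega>))}" for n
    using sample_event_measurable[OF prob iid, of "\<lambda>vs. ?min n vs (\<beta>h n vs)" n]
    by (subst prob_neg) auto
  ultimately have minimizes: "(\<lambda>n. prob {\<omega> \<in> space M. ?min n (sample V n \<omega>) (\<beta>h n (sample V n \<omega>))}) \<longlonglongrightarrow> 1"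
    by simp
  have "whp M V (\<lambda>n vs. active_set J p \<beta>s \<subseteq> active_set J p (\<beta>h n vs))"
    by (rule whp_mono[OF prob iid close], intro always_eventually allI ballI impI) (use \<beta>h in blast)
  then have screening: "\<exists>N>0. \<forall>n\<ge>N. (\<Sum>j\<in>{1..J}. p j) < n \<longrightarrow>
      prob {\<omega> \<in> space M. \<not> active_set J p \<beta>s \<subseteq> active_set J p (\<beta>h n (sample V n \<omega>))} < e" if "e > 0" for e
  proof -
    assume "whp M V (\<lambda>n vs. active_set J p \<beta>s \<subseteq> active_set J p (\<beta>h n vs))"
    then have "\<forall>\<^sub>F n in sequentially.
        prob {\<omega> \<in> space M. \<not> active_set J p \<beta>s \<subseteq> active_set J p (\<beta>h n (sample V n \<omega>))} < e"
      unfolding whp_def using that by (rule order_tendstoD(2))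
    then obtain N where "\<forall>n\<ge>N.
        prob {\<omega> \<in> space M. \<not> active_set J p \<beta>s \<subseteq> active_set J p (\<beta>h n (sample V n \<omega>))} < e"
      by (auto simp: eventually_sequentially)
    then show ?thesis by (intro exI[of _ "Suc N"]) auto
  qed
  show ?thesis
    using est minimizes screening by (intro exI[of _ \<beta>h]) blast
qed

end
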